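(* Let $q$ be a prime integer, let $d\ge 1$, $N\ge1$ and $0\le i\le d-1$ be integers, let $p_2,p_1\in[0,1]$, and let $\mathbb{T}=\mathbb{T}_N^d$ be the $d$-dimensional discrete torus of width $N$. Set $$p_2^{\bullet}=\frac{q(1-p_1)}{p_1+q(1-p_1)},\qquad p_1^{\bullet}=\frac{q(1-p_2)}{p_2+q(1-p_2)},$$ and let $\rho=\rho_{p_2,p_1,q,i,\mathbb{T}}$ and $\rho^{\bullet}=\rho_{p_2^{\bullet},p_1^{\bullet},q,d-i-1,\mathbb{T}^\bullet}$ be the corresponding coupled plaquette percolations. Then for all percolation subcomplexes $P_2,P_1$ of $\mathbb{T}$ of dimensions $i+1$ and $i$ respectively, $$\rho(P_2,P_1)=\rho^{\bullet}(P_1^{\bullet},P_2^{\bullet}).$$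
   Context: $\mathbb{T}_N^d$ is the cubical cell complex obtained from the cube $[0,N]^d$, tessellated by unit cubes with integer vertices, by identifying opposite faces. $\mathbb{T}^\bullet$ is the same lattice shifted by $1/2$ in every coordinate. Each $j$-cell $x$ of $\mathbb{T}$ has a unique dual $(d-j)$-cell $x'$ of $\mathbb{T}^\bullet$ (with the same center). For a subcomplex $P$ of $\mathbb{T}$, $P^\bullet=\{x'\in\mathbb{T}^\bullet: x\notin P\}$; if $P$ is a $j$-dimensional percolation subcomplex then $P^\bullet$ is a $(d-j)$-dimensional percolation subcomplex of $\mathbb{T}^\bullet$. For a cell complex $X$: $X^{[j]}$ is the set of $j$-cells and $X^{(j)}$ the $j$-skeleton. $C^j(X;\mathbb{Z}_q)$ is the group of functions $f$ from oriented $j$-cells to $\mathbb{Z}_q$ (integers modulo $q$) with $f(-x)=-f(x)$; $\delta f(x)=f(\partial x)$ with $\partial$ the cellular boundary. A $j$-dimensional percolation subcomplex of $X$ is a subcomplex $P$ with $X^{(j-1)}\subseteq P\subseteq X^{(j)}$; $|P|$ is its number of $j$-cells. For a non-negative integer $i$, the coupled plaquette percolation $\rho_{p_2,p_1,q,i,X}$ is the probability measure on pairs $(P_2,P_1)$ of percolation subcomplexes of $X$ of dimensions $i+1$ and $i$ with $$\rho(P_2,P_1)\propto p_2^{|P_2|}(1-p_2)^{|X^{[i+1]}|-|P_2|}\,p_1^{|P_1|}(1-p_1)^{|X^{[i]}|-|P_1|}\,|H^i(P_2,P_1;\mathbb{Z}_q)|,$$ where the relative cohomology $H^i(P_2,P_1;\mathbb{Z}_q)$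 coincides with the group of $f\in C^i(X;\mathbb{Z}_q)$ such that $f(\epsilon)=0$ for all $i$-cells $\epsilon$ of $P_1$ and $\delta f(\sigma)=0$ for all $(i+1)$-cells $\sigma$ of $P_2$. *)

theory Defs
  imports "HOL-Probability.Probability" "HOL-Computational_Algebra.Primes"
begin

section \<open>Cell complexes\<close>

text \<open>
  A cell complex is recorded by its cells, their dimensions, the relation ``y is a face of x''
  (\<open>face y x\<close>; y lies in the closed cell x), and, for a chosen reference orientation of every
  cell, the coefficient \<open>inc x y\<close> of y in the cellular boundary of x.
\<close>

record 'a cell_complex =
  cells :: "'a set"
  cdim :: "'a \<Rightarrow> nat"
  face :: "'a \<Rightarrow> 'a \<Rightarrow> bool"
  inc :: "'a \<Rightarrow> 'a \<Rightarrow> int"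

definition jcells :: "'a cell_complex \<Rightarrow> nat \<Rightarrow> 'a set" where
  "jcells X j = {x \<in> cells X. cdim X x = j}"

text \<open>The dimension is an integer, so that the (-1)-skeleton is the empty complex.\<close>

definition skeleton :: "'a cell_complex \<Rightarrow> int \<Rightarrow> 'a set" where
  "skeleton X j = {x \<in> cells X. int (cdim X x) \<le> j}"

definition subcomplex :: "'a cell_complex \<Rightarrow> 'a set \<Rightarrow> bool" where
  "subcomplex X P \<longleftrightarrow>
     P \<subseteq> cells X \<and> (\<forall>x\<in>P. \<forall>y\<in>cells X. face X y x \<longrightarrow> y \<in> P)"

definition percolation_subcomplexes :: "'a cell_complex \<Rightarrow> nat \<Rightarrow> 'a set set" where
  "percolation_subcomplexes X j =
     {P. subcomplex X P \<and> skeleton X (int j - 1) \<subseteq> P \<and> P \<subseteq> skeleton X (int j)}"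


section \<open>Relative cohomology with coefficients in the integers modulo q\<close>

text \<open>
  The oriented cells are the pairs \<open>(x, s)\<close>, where \<open>s = True\<close> stands for the reference
  orientation of x. The integers modulo q are represented by their residues in \<open>{0..<q}\<close>.
  Everything below concerns the subcomplex A of X.
\<close>

definition oriented_cells :: "'a cell_complex \<Rightarrow> 'a set \<Rightarrow> nat \<Rightarrow> ('a \<times> bool) set" where
  "oriented_cells X A j = (A \<inter> jcells X j) \<times> UNIV"

definition reverse :: "'a \<times> bool \<Rightarrow> 'a \<times> bool" where
  "reverse \<sigma> = (fst \<sigma>, \<not> snd \<sigma>)"

definition cochains ::
    "nat \<Rightarrow> 'a cell_complex \<Rightarrow> 'a set \<Rightarrow> nat \<Rightarrow> ('a \<times> bool \<Rightarrow> int) set" where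
  "cochains q X A j =
     {f \<in> oriented_cells X A j \<rightarrow>\<^sub>E {0..<int q}.
        \<forall>\<sigma>\<in>oriented_cells X A j. f (reverse \<sigma>) = (- f \<sigma>) mod int q}"

definition boundary_coeff :: "'a cell_complex \<Rightarrow> 'a \<times> bool \<Rightarrow> 'a \<Rightarrow> int" where
  "boundary_coeff X \<sigma> y = (if snd \<sigma> then inc X (fst \<sigma>) y else - inc X (fst \<sigma>) y)"

definition coboundary ::
    "nat \<Rightarrow> 'a cell_complex \<Rightarrow> 'a set \<Rightarrow> nat \<Rightarrow> ('a \<times> bool \<Rightarrow> int) \<Rightarrow> 'a \<times> bool \<Rightarrow> int" where
  "coboundary q X A j f =
     (\<lambda>\<sigma>\<in>oriented_cells X A (j + 1).
        (\<Sum>y\<in>A \<inter> jcells X j. boundary_coeff X \<sigma> y * f (y, True)) mod int q)"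

definition zero_cochain :: "'a cell_complex \<Rightarrow> 'a set \<Rightarrow> nat \<Rightarrow> 'a \<times> bool \<Rightarrow> int" where
  "zero_cochain X A j = (\<lambda>\<sigma>\<in>oriented_cells X A j. 0)"

definition relative_cochains ::
    "nat \<Rightarrow> 'a cell_complex \<Rightarrow> 'a set \<Rightarrow> 'a set \<Rightarrow> nat \<Rightarrow> ('a \<times> bool \<Rightarrow> int) set" where
  "relative_cochains q X A B j =
     {f \<in> cochains q X A j. \<forall>\<sigma>\<in>oriented_cells X (A \<inter> B) j. f \<sigma> = 0}"

definition relative_cocycles ::
    "nat \<Rightarrow> 'a cell_complex \<Rightarrow> 'a set \<Rightarrow> 'a set \<Rightarrow> nat \<Rightarrow> ('a \<times> bool \<Rightarrow> int) set" where
  "relative_cocycles q X A B j =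
     {f \<in> relative_cochains q X A B j. coboundary q X A j f = zero_cochain X A (j + 1)}"

definition relative_coboundaries ::
    "nat \<Rightarrow> 'a cell_complex \<Rightarrow> 'a set \<Rightarrow> 'a set \<Rightarrow> nat \<Rightarrow> ('a \<times> bool \<Rightarrow> int) set" where
  "relative_coboundaries q X A B j =
     (if j = 0 then {zero_cochain X A 0}
      else coboundary q X A (j - 1) ` relative_cochains q X A B (j - 1))"

definition cohomologous ::
    "nat \<Rightarrow> 'a cell_complex \<Rightarrow> 'a set \<Rightarrow> 'a set \<Rightarrow> nat \<Rightarrow>
      (('a \<times> bool \<Rightarrow> int) \<times> ('a \<times> bool \<Rightarrow> int)) set" where
  "cohomologous q X A B j =
     {(f, g). f \<in> relative_cocycles q X A B j \<and> g \<in> relative_cocycles q X A B j \<and>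
        (\<lambda>\<sigma>\<in>oriented_cells X A j. (f \<sigma> - g \<sigma>) mod int q) \<in> relative_coboundaries q X A B j}"

definition relative_cohomology ::
    "nat \<Rightarrow> 'a cell_complex \<Rightarrow> 'a set \<Rightarrow> 'a set \<Rightarrow> nat \<Rightarrow> ('a \<times> bool \<Rightarrow> int) set set" where
  "relative_cohomology q X A B j = relative_cocycles q X A B j // cohomologous q X A B j"


section \<open>Coupled plaquette percolation\<close>

definition coupled_weight ::
    "real \<Rightarrow> real \<Rightarrow> nat \<Rightarrow> nat \<Rightarrow> 'a cell_complex \<Rightarrow> 'a set \<Rightarrow> 'a set \<Rightarrow> real" where
  "coupled_weight p2 p1 q i X P2 P1 =
     p2 ^ card (P2 \<inter> jcells X (i + 1))
     * (1 - p2) ^ (card (jcells X (i + 1)) - card (P2 \<inter> jcells X (i + 1)))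
     * p1 ^ card (P1 \<inter> jcells X i)
     * (1 - p1) ^ (card (jcells X i) - card (P1 \<inter> jcells X i))
     * real (card (relative_cohomology q X P2 P1 i))"

definition coupled_configurations :: "nat \<Rightarrow> 'a cell_complex \<Rightarrow> ('a set \<times> 'a set) set" where
  "coupled_configurations i X =
     percolation_subcomplexes X (i + 1) \<times> percolation_subcomplexes X i"

definition coupled_partition_function ::
    "real \<Rightarrow> real \<Rightarrow> nat \<Rightarrow> nat \<Rightarrow> 'a cell_complex \<Rightarrow> real" where
  "coupled_partition_function p2 p1 q i X =
     (\<Sum>(P2, P1)\<in>coupled_configurations i X. coupled_weight p2 p1 q i X P2 P1)"

definition coupled_percolation ::
    "real \<Rightarrow> real \<Rightarrow> nat \<Rightarrow> nat \<Rightarrow> 'a cell_complex \<Rightarrow> ('a set \<times> 'a set) pmf" where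
  "coupled_percolation p2 p1 q i X =
     embed_pmf (\<lambda>(P2, P1).
       if (P2, P1) \<in> coupled_configurations i X
       then coupled_weight p2 p1 q i X P2 P1 / coupled_partition_function p2 p1 q i X
       else 0)"


section \<open>The discrete torus and its dual\<close>

text \<open>
  Coordinates are measured in units of one half: the torus is \<open>(\<real> / 2N)\<close> to the power d, the
  vertices of the lattice have even coordinates, and those of the lattice shifted by 1/2 have odd
  coordinates. The cube \<open>(v, S)\<close> has least corner v and extends from v by one lattice step (two
  half units) in the directions of S.
\<close>

type_synonym cube = "(nat \<Rightarrow> int) \<times> nat set"

definition shifted_torus_cells :: "nat \<Rightarrow> nat \<Rightarrow> int \<Rightarrow> cube set" where
  "shifted_torus_cells d N s =
     ({..<d} \<rightarrow>\<^sub>E {a \<in> {0..<2 * int N}. a mod 2 = s}) \<times> Pow {..<d}"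

definition cube_dim :: "cube \<Rightarrow> nat" where
  "cube_dim x = card (snd x)"

definition step :: "nat \<Rightarrow> int \<Rightarrow> int" where
  "step N a = (a + 2) mod (2 * int N)"

definition cube_face :: "nat \<Rightarrow> cube \<Rightarrow> cube \<Rightarrow> bool" where
  "cube_face N y x \<longleftrightarrow>
     snd y \<subseteq> snd x \<and>
     (\<forall>k. fst y k = fst x k \<or> k \<in> snd x - snd y \<and> fst y k = step N (fst x k))"

definition front_face :: "cube \<Rightarrow> nat \<Rightarrow> cube" where
  "front_face x k = (fst x, snd x - {k})"

definition back_face :: "nat \<Rightarrow> cube \<Rightarrow> nat \<Rightarrow> cube" where
  "back_face N x k = ((fst x)(k := step N (fst x k)), snd x - {k})"

text \<open>
  The reference orientation of a cube is given by the increasing order of its directions. If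
  \<open>N = 1\<close> then opposite faces coincide and their contributions cancel.
\<close>

definition cube_inc :: "nat \<Rightarrow> cube \<Rightarrow> cube \<Rightarrow> int" where
  "cube_inc N x y =
     (\<Sum>k\<in>snd x. (-1) ^ card {l \<in> snd x. l < k} *
        (of_bool (y = back_face N x k) - of_bool (y = front_face x k)))"

definition shifted_torus :: "nat \<Rightarrow> nat \<Rightarrow> int \<Rightarrow> cube cell_complex" where
  "shifted_torus d N s =
     \<lparr>cells = shifted_torus_cells d N s, cdim = cube_dim, face = cube_face N, inc = cube_inc N\<rparr>"

definition torus :: "nat \<Rightarrow> nat \<Rightarrow> cube cell_complex" where
  "torus d N = shifted_torus d N 0"

definition dual_torus :: "nat \<Rightarrow> nat \<Rightarrow> cube cell_complex" where
  "dual_torus d N = shifted_torus d N 1"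

definition center :: "nat \<Rightarrow> nat \<Rightarrow> cube \<Rightarrow> nat \<Rightarrow> int" where
  "center d N x = (\<lambda>k\<in>{..<d}. (fst x k + of_bool (k \<in> snd x)) mod (2 * int N))"

definition dual_cell :: "nat \<Rightarrow> nat \<Rightarrow> cube \<Rightarrow> cube" where
  "dual_cell d N x =
     (THE y. y \<in> jcells (dual_torus d N) (d - cube_dim x) \<and> center d N y = center d N x)"

definition dual_subcomplex :: "nat \<Rightarrow> nat \<Rightarrow> cube set \<Rightarrow> cube set" where
  "dual_subcomplex d N P = {dual_cell d N x |x. x \<in> cells (torus d N) \<and> x \<notin> P}"

lemma jcells_subset_percolation:
  assumes "P \<in> percolation_subcomplexes X j" "i < j"
  shows "jcells X i \<subseteq> P"
  using assms unfolding percolation_subcomplexes_def skeleton_def jcells_def by fastforce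

lemma zero_cochain_relative:
  assumes "q > 0" shows "zero_cochain X A j \<in> relative_cocycles q X A B j"
  using assms
  by (auto simp: relative_cocycles_def relative_cochains_def cochains_def zero_cochain_def
      oriented_cells_def reverse_def coboundary_def fun_eq_iff)

lemma relative_coboundaries_percolation:
  assumes "q > 0" and P: "P2 \<in> percolation_subcomplexes X (i + 1)" "P1 \<in> percolation_subcomplexes X i"
  shows "relative_coboundaries q X P2 P1 i = {zero_cochain X P2 i}"
proof (cases i)
  case 0
  then show ?thesis by (simp add: relative_coboundaries_def)
next
  case (Suc k)
  have sub: "jcells X k \<subseteq> P1" "jcells X k \<subseteq> P2"
    using jcells_subset_percolation[OF P(1), of k] jcells_subset_percolation[OF P(2), of k] Suc by auto
  have eq: "relative_cochains q X P2 P1 k = {zero_cochain X P2 k}"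
  proof
    have "zero_cochain X P2 k \<in> relative_cochains q X P2 P1 k"
      using zero_cochain_relative[OF assms(1)] by (auto simp: relative_cocycles_def)
    then show "{zero_cochain X P2 k} \<subseteq> relative_cochains q X P2 P1 k" by simp
    show "relative_cochains q X P2 P1 k \<subseteq> {zero_cochain X P2 k}"
    proof
      fix f assume f: "f \<in> relative_cochains q X P2 P1 k"
      have "f \<sigma> = zero_cochain X P2 k \<sigma>" for \<sigma>
      proof (cases "\<sigma> \<in> oriented_cells X P2 k")
        case True
        then show ?thesis using f sub
          by (auto simp: relative_cochains_def zero_cochain_def oriented_cells_def)
      next
        case False
        then show ?thesis using f
          by (auto simp: relative_cochains_def cochains_def zero_cochain_def intro: PiE_arb)
      qed
      then show "f \<in> {zero_cochain X P2 k}" by auto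
    qed
  qed
  have "coboundary q X P2 k (zero_cochain X P2 k) = zero_cochain X P2 i"
    using Suc by (auto simp: coboundary_def zero_cochain_def oriented_cells_def fun_eq_iff
        intro!: sum.neutral)
  then show ?thesis using Suc eq by (simp add: relative_coboundaries_def)
qed

lemma relative_cocycles_range:
  assumes "f \<in> relative_cocycles q X A B j" "\<sigma> \<in> oriented_cells X A j"
  shows "0 \<le> f \<sigma>" "f \<sigma> < int q"
  using assms by (auto simp: relative_cocycles_def relative_cochains_def cochains_def
      PiE_iff)

lemma relative_cocycles_undef:
  assumes "f \<in> relative_cocycles q X A B j" "\<sigma> \<notin> oriented_cells X A j"
  shows "f \<sigma> = undefined"
  using assms by (auto simp: relative_cocycles_def relative_cochains_def cochains_def
      intro: PiE_arb)

lemma cohomologous_percolation: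
  assumes "q > 0" and P: "P2 \<in> percolation_subcomplexes X (i + 1)" "P1 \<in> percolation_subcomplexes X i"
  shows "cohomologous q X P2 P1 i = Id_on (relative_cocycles q X P2 P1 i)"
proof -
  have "f = g" if f: "f \<in> relative_cocycles q X P2 P1 i" and g: "g \<in> relative_cocycles q X P2 P1 i"
    and h: "(\<lambda>\<sigma>\<in>oriented_cells X P2 i. (f \<sigma> - g \<sigma>) mod int q) = zero_cochain X P2 i" for f g
  proof
    fix \<sigma>
    show "f \<sigma> = g \<sigma>"
    proof (cases "\<sigma> \<in> oriented_cells X P2 i")
      case True
      have "(f \<sigma> - g \<sigma>) mod int q = 0"
        using fun_cong[OF h, of \<sigma>] True by (simp add: zero_cochain_def)
      then have "f \<sigma> mod int q = g \<sigma> mod int q" by (simp add: mod_eq_dvd_iff mod_0_imp_dvd)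
      then show ?thesis
        using relative_cocycles_range[OF f True] relative_cocycles_range[OF g True] by simp
    next
      case False
      then show ?thesis using relative_cocycles_undef[OF f] relative_cocycles_undef[OF g] by simp
    qed
  qed
  moreover have "(\<lambda>\<sigma>\<in>oriented_cells X P2 i. (f \<sigma> - f \<sigma>) mod int q) = zero_cochain X P2 i"
    for f :: "'a \<times> bool \<Rightarrow> int"
    by (simp add: zero_cochain_def)
  ultimately show ?thesis
    unfolding cohomologous_def relative_coboundaries_percolation[OF assms] Id_on_def by auto
qed

text \<open>
  For percolation subcomplexes, the relative cohomology is the group of those cochains of X which
  vanish on the i-cells of \<open>P1\<close> and whose coboundary vanishes on the (i+1)-cells of \<open>P2\<close>.
\<close>

theorem card_relative_cohomology:
  assumes "q > 0" and P: "P2 \<in> percolation_subcomplexes X (i + 1)" "P1 \<in> percolation_subcomplexes X i"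
  shows "card (relative_cohomology q X P2 P1 i) =
    card {f \<in> cochains q X (cells X) i.
      (\<forall>\<sigma>\<in>oriented_cells X P1 i. f \<sigma> = 0) \<and>
      (\<forall>\<sigma>\<in>oriented_cells X P2 (i + 1). coboundary q X (cells X) i f \<sigma> = 0)}" (is "_ = card ?G")
proof -
  let ?Z = "relative_cocycles q X P2 P1 i"
  have "relative_cohomology q X P2 P1 i = (\<lambda>f. {f}) ` ?Z"
    unfolding relative_cohomology_def cohomologous_percolation[OF assms] quotient_def by auto
  then have "card (relative_cohomology q X P2 P1 i) = card ?Z"
    by (simp add: card_image)
  also have "?Z = ?G"
  proof -
    have sub: "P1 \<subseteq> cells X" "P2 \<subseteq> cells X"
      using P by (auto simp: percolation_subcomplexes_def subcomplex_def)
    have j: "P2 \<inter> jcells X i = cells X \<inter> jcells X i" "P2 \<inter> P1 \<inter> jcells X i = P1 \<inter> jcells X i"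
      using jcells_subset_percolation[OF P(1), of i] sub by (auto simp: jcells_def)
    then have o: "oriented_cells X P2 i = oriented_cells X (cells X) i"
      "oriented_cells X (P2 \<inter> P1) i = oriented_cells X P1 i"
      by (simp_all add: oriented_cells_def)
    have "oriented_cells X P2 (i + 1) \<subseteq> oriented_cells X (cells X) (i + 1)"
      using sub by (auto simp: oriented_cells_def)
    then have "coboundary q X P2 i f = zero_cochain X P2 (i + 1) \<longleftrightarrow>
        (\<forall>\<sigma>\<in>oriented_cells X P2 (i + 1). coboundary q X (cells X) i f \<sigma> = 0)" for f
      unfolding coboundary_def zero_cochain_def j(1) fun_eq_iff restrict_def by auto
    then show ?thesis
      by (simp add: relative_cocycles_def relative_cochains_def cochains_def o)
  qed
  finally show ?thesis .
qed

lemma finite_relative_cocycles: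
  assumes "finite (cells X)" shows "finite (relative_cocycles q X A B j)"
proof -
  have "finite (oriented_cells X A j)"
    using assms by (auto simp: oriented_cells_def jcells_def)
  then have "finite (oriented_cells X A j \<rightarrow>\<^sub>E {0..<int q})" by (intro finite_PiE) auto
  then show ?thesis
    by (rule finite_subset[rotated]) (auto simp: relative_cocycles_def relative_cochains_def cochains_def)
qed

lemma card_relative_cohomology_pos:
  assumes "finite (cells X)" "q > 0"
  shows "card (relative_cohomology q X A B j) > 0"
proof -
  have "cohomologous q X A B j \<subseteq> relative_cocycles q X A B j \<times> relative_cocycles q X A B j"
    by (auto simp: cohomologous_def)
  then have "finite (relative_cohomology q X A B j)"
    unfolding relative_cohomology_def
    using finite_relative_cocycles[OF assms(1)] by (auto simp: quotient_def)
  moreover have "relative_cohomology q X A B j \<noteq> {}"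
    using zero_cochain_relative[OF assms(2)] by (fastforce simp: relative_cohomology_def quotient_def)
  ultimately show ?thesis by (simp add: card_gt_0_iff)
qed

lemma coupled_weight_nonneg:
  assumes "p2 \<in> {0..1}" "p1 \<in> {0..1}"
  shows "coupled_weight p2 p1 q i X P2 P1 \<ge> 0"
  using assms by (auto simp: coupled_weight_def)

lemma finite_coupled_configurations:
  assumes "finite (cells X)" shows "finite (coupled_configurations i X)"
proof -
  have "percolation_subcomplexes X j \<subseteq> Pow (cells X)" for j
    by (auto simp: percolation_subcomplexes_def skeleton_def)
  then show ?thesis
    unfolding coupled_configurations_def using assms by (meson finite_Pow_iff finite_SigmaI finite_subset)
qed

lemma skeleton_percolation:
  assumes "\<And>x y. x \<in> cells X \<Longrightarrow> face X y x \<Longrightarrow> cdim X y \<le> cdim X x"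
  shows "skeleton X (int j) \<in> percolation_subcomplexes X j"
    "skeleton X (int j - 1) \<in> percolation_subcomplexes X j"
  using assms by (fastforce simp: percolation_subcomplexes_def skeleton_def subcomplex_def)+

lemma coupled_partition_function_pos:
  assumes "finite (cells X)" "\<And>x y. x \<in> cells X \<Longrightarrow> face X y x \<Longrightarrow> cdim X y \<le> cdim X x" "q > 0"
    and p: "p2 \<in> {0..1}" "p1 \<in> {0..1}"
  shows "coupled_partition_function p2 p1 q i X > 0"
proof -
  have one: "\<exists>P\<in>percolation_subcomplexes X j. p ^ card (P \<inter> jcells X j)
      * (1 - p) ^ (card (jcells X j) - card (P \<inter> jcells X j)) > 0"
    if "p \<in> {0..1}" for p :: real and j
  proof (cases "p = 1")
    case True
    have "skeleton X (int j) \<inter> jcells X j = jcells X j" by (auto simp: skeleton_def jcells_def)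
    then show ?thesis using skeleton_percolation(1)[OF assms(2)] True
      by (intro bexI[of _ "skeleton X (int j)"]) simp_all
  next
    case False
    have "skeleton X (int j - 1) \<inter> jcells X j = {}" by (auto simp: skeleton_def jcells_def)
    then show ?thesis using skeleton_percolation(2)[OF assms(2)] False that
      by (intro bexI[of _ "skeleton X (int j - 1)"]) simp_all
  qed
  obtain P2 where P2: "P2 \<in> percolation_subcomplexes X (i + 1)"
    "p2 ^ card (P2 \<inter> jcells X (i + 1))
      * (1 - p2) ^ (card (jcells X (i + 1)) - card (P2 \<inter> jcells X (i + 1))) > 0"
    using one[OF p(1)] by blast
  obtain P1 where P1: "P1 \<in> percolation_subcomplexes X i"
    "p1 ^ card (P1 \<inter> jcells X i) * (1 - p1) ^ (card (jcells X i) - card (P1 \<inter> jcells X i)) > 0"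
    using one[OF p(2)] by blast
  have "0 < coupled_weight p2 p1 q i X P2 P1"
    using mult_pos_pos[OF mult_pos_pos[OF P2(2) P1(2)],
        of "real (card (relative_cohomology q X P2 P1 i))"]
      card_relative_cohomology_pos[OF assms(1,3), of P2 P1 i]
    by (simp add: coupled_weight_def mult_ac)
  moreover have "(P2, P1) \<in> coupled_configurations i X"
    using P2 P1 by (simp add: coupled_configurations_def)
  ultimately show ?thesis
    unfolding coupled_partition_function_def
    using finite_coupled_configurations[OF assms(1)] coupled_weight_nonneg[OF p]
    by (intro sum_pos2[where i = "(P2, P1)"]) auto
qed

text \<open>The masses in the definition of the measure are nonnegative and add up to one.\<close>

theorem pmf_coupled_percolation:
  assumes "finite (cells X)" "\<And>x y. x \<in> cells X \<Longrightarrow> face X y x \<Longrightarrow> cdim X y \<le> cdim X x" "q > 0"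
    and p: "p2 \<in> {0..1}" "p1 \<in> {0..1}"
  shows "pmf (coupled_percolation p2 p1 q i X) (P2, P1) =
    (if (P2, P1) \<in> coupled_configurations i X
     then coupled_weight p2 p1 q i X P2 P1 / coupled_partition_function p2 p1 q i X else 0)"
proof -
  let ?C = "coupled_configurations i X" and ?Z = "coupled_partition_function p2 p1 q i X"
  let ?m = "\<lambda>(P2, P1). if (P2, P1) \<in> ?C then coupled_weight p2 p1 q i X P2 P1 / ?Z else 0"
  note Z = coupled_partition_function_pos[OF assms, of i]
  note fin = finite_coupled_configurations[OF assms(1), of i]
  have nn: "0 \<le> ?m c" for c
    by (auto split: prod.split intro!: divide_nonneg_nonneg coupled_weight_nonneg[OF p] less_imp_le[OF Z])
  have "(\<integral>\<^sup>+c. ennreal (?m c) \<partial>count_space UNIV) = (\<Sum>c\<in>?C. ennreal (?m c))"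
    using fin by (intro nn_integral_count_space') (auto split: if_splits)
  also have "\<dots> = ennreal (\<Sum>c\<in>?C. ?m c)" using nn by (intro sum_ennreal) auto
  also have "(\<Sum>c\<in>?C. ?m c) = (\<Sum>(P2, P1)\<in>?C. coupled_weight p2 p1 q i X P2 P1) / ?Z"
    unfolding sum_divide_distrib by (intro sum.cong) auto
  also have "\<dots> = 1" using Z unfolding coupled_partition_function_def[symmetric] by simp
  finally have "(\<integral>\<^sup>+c. ennreal (?m c) \<partial>count_space UNIV) = 1" by simp
  from pmf_embed_pmf[of ?m, OF nn this] show ?thesis unfolding coupled_percolation_def by simp
qed

lemma finite_shifted_torus: "finite (cells (shifted_torus d N s))"
proof -
  have "finite {a \<in> {0..<2 * int N}. a mod 2 = s}"
    by (rule finite_subset[of _ "{0..<2 * int N}"]) auto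
  then have "finite ({..<d} \<rightarrow>\<^sub>E {a \<in> {0..<2 * int N}. a mod 2 = s})" by (intro finite_PiE) auto
  then show ?thesis by (simp add: shifted_torus_def shifted_torus_cells_def)
qed

lemma shifted_torus_face_dim:
  assumes "x \<in> cells (shifted_torus d N s)" "face (shifted_torus d N s) y x"
  shows "cdim (shifted_torus d N s) y \<le> cdim (shifted_torus d N s) x"
proof -
  have "finite (snd x)"
    using assms(1) by (auto simp: shifted_torus_def shifted_torus_cells_def intro: finite_subset[OF _ finite_lessThan[of d]])
  then show ?thesis
    using assms(2) by (auto simp: shifted_torus_def cube_face_def cube_dim_def intro: card_mono)
qed

text \<open>Every cell of the torus has exactly one dual cell, so the description in \<open>dual_cell_def\<close> is proper.\<close>

lemma ex1_dual_cell:
  assumes x: "x \<in> cells (torus d N)"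
  shows "\<exists>!y. y \<in> jcells (dual_torus d N) (d - cube_dim x) \<and> center d N y = center d N x"
proof -
  obtain v S where xv: "x = (v, S)" by force
  have v: "v \<in> extensional {..<d}" "\<And>k. k < d \<Longrightarrow> 0 \<le> v k \<and> v k < 2 * int N \<and> v k mod 2 = 0"
    and S: "S \<subseteq> {..<d}"
    using x by (auto simp: xv torus_def shifted_torus_def shifted_torus_cells_def PiE_iff)
  define w where "w = (\<lambda>k\<in>{..<d}. (if k \<in> S then v k + 1 else (v k - 1) mod (2 * int N)))"
  have par: "a mod (2 * int N) mod 2 = a mod 2" for a
    by (rule mod_mod_cancel) simp
  have bound: "v k + 1 < 2 * int N" if "k < d" for k
  proof -
    have "v k \<noteq> 2 * int N - 1" using v(2)[OF that] by presburger
    then show ?thesis using v(2)[OF that] by linarith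
  qed
  have wr: "w k \<in> {a \<in> {0..<2 * int N}. a mod 2 = 1}" if "k < d" for k
  proof -
    have "N > 0" using v(2)[OF that] by auto
    moreover have "(v k - 1) mod (2 * int N) mod 2 = 1"
      unfolding par using v(2)[OF that] by presburger
    moreover have "(v k + 1) mod 2 = 1" using v(2)[OF that] by presburger
    ultimately show ?thesis using bound[OF that] v(2)[OF that] that by (auto simp: w_def)
  qed
  have "(w, {..<d} - S) \<in> cells (dual_torus d N)"
    using wr by (auto simp: dual_torus_def shifted_torus_def shifted_torus_cells_def w_def PiE_iff extensional_def)
  moreover have "card ({..<d} - S) = d - card S"
    using S by (simp add: card_Diff_subset finite_subset)
  moreover have "center d N (w, {..<d} - S) = center d N x"
    using S by (auto simp: center_def xv w_def fun_eq_iff mod_simps)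
  ultimately have ex: "(w, {..<d} - S) \<in> jcells (dual_torus d N) (d - cube_dim x) \<and>
      center d N (w, {..<d} - S) = center d N x"
    by (simp add: jcells_def dual_torus_def shifted_torus_def cube_dim_def xv)
  have uniq: "y = z" if y: "y \<in> cells (dual_torus d N)" and z: "z \<in> cells (dual_torus d N)"
    and c: "center d N y = center d N z" for y z
  proof -
    obtain a A where ya: "y = (a, A)" by force
    obtain b B where zb: "z = (b, B)" by force
    have a: "a \<in> extensional {..<d}" "\<And>k. k < d \<Longrightarrow> 0 \<le> a k \<and> a k < 2 * int N \<and> a k mod 2 = 1" "A \<subseteq> {..<d}"
      using y by (auto simp: ya dual_torus_def shifted_torus_def shifted_torus_cells_def PiE_iff)
    have b: "b \<in> extensional {..<d}" "\<And>k. k < d \<Longrightarrow> 0 \<le> b k \<and> b k < 2 * int N \<and> b k mod 2 = 1" "B \<subseteq> {..<d}"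
      using z by (auto simp: zb dual_torus_def shifted_torus_def shifted_torus_cells_def PiE_iff)
    have ck: "(a k + of_bool (k \<in> A)) mod (2 * int N) = (b k + of_bool (k \<in> B)) mod (2 * int N)"
      if "k < d" for k
      using fun_cong[OF c, of k] that by (simp add: center_def ya zb)
    have AB: "k \<in> A \<longleftrightarrow> k \<in> B" if "k < d" for k
    proof -
      have "(a k + of_bool (k \<in> A)) mod 2 = (b k + of_bool (k \<in> B)) mod 2"
        using ck[OF that] par by metis
      then show ?thesis using a(2)[OF that] b(2)[OF that]
        by (cases "k \<in> A"; cases "k \<in> B") (auto, presburger+)
    qed
    have "a k = b k" if "k < d" for k
    proof -
      have "(a k + of_bool (k \<in> B) - of_bool (k \<in> B)) mod (2 * int N) =
          (b k + of_bool (k \<in> B) - of_bool (k \<in> B)) mod (2 * int N)"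
        using ck[OF that] AB[OF that] by (intro mod_diff_cong) auto
      then show ?thesis using a(2)[OF that] b(2)[OF that] by simp
    qed
    then have "a = b" using a(1) b(1) by (auto simp: extensional_def fun_eq_iff) (metis)
    moreover have "A = B" using AB a(3) b(3) by auto
    ultimately show ?thesis by (simp add: ya zb)
  qed
  show ?thesis
    using ex uniq by (intro ex1I[of _ "(w, {..<d} - S)"]) (auto simp: jcells_def)
qed

end

theory Submission
  imports Defs
begin

text \<open>
  For percolation subcomplexes the relative cohomology is the kernel, modulo q, of a submatrix M of the
  incidence matrix: its rows are the (i+1)-cells of \<open>P2\<close>, its columns the i-cells outside \<open>P1\<close>.
  For the dual pair the same submatrix appears transposed, because a cell y is a face of x exactly if
  the dual of x is a face of the dual of y. The incidence numbers agree up to a sign which is a product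
  of a sign for x and a sign for y (\<open>cube_inc_dual_cube\<close>), and such signs do not change the size of a
  kernel (\<open>card_mod_kernel_sign\<close>).

  So the only input from linear algebra is the relation between the kernels of a matrix and of its
  transpose, \<open>|ker M| q ^ (number of rows) = |ker M\<^sup>T| q ^ (number of columns)\<close>
  (\<open>card_mod_kernel_transpose\<close>). It is obtained by evaluating a sum of characters over all pairs of
  vectors in two orders. Hence the sizes of the two cohomology groups differ by the factor
  \<open>q ^ (columns - rows)\<close>, where the numbers of rows and columns count (i+1)-cells of \<open>P2\<close> and
  i-cells outside \<open>P1\<close>. This factor is a product of local ones, and the dual parameters are those for
  which the dual weight becomes the original weight times a constant (\<open>coupled_weight_dual\<close>). As
  duality is a bijection of configurations (\<open>bij_betw_dual_subcomplex\<close>), the partition functions have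
  the same ratio, and the probabilities agree.
\<close>

section \<open>Kernels of a matrix and of its transpose modulo q\<close>

definition mod_kernel :: "nat \<Rightarrow> ('r \<Rightarrow> 'k \<Rightarrow> int) \<Rightarrow> 'r set \<Rightarrow> 'k set \<Rightarrow> ('k \<Rightarrow> int) set" where
  "mod_kernel q M R K =
     {g \<in> K \<rightarrow>\<^sub>E {0..<int q}. \<forall>r\<in>R. int q dvd (\<Sum>k\<in>K. M r k * g k)}"

text \<open>
  The character sending n to \<open>exp (2 \<pi> i n / q)\<close>, which detects divisibility by q.
\<close>

definition additive_char :: "nat \<Rightarrow> int \<Rightarrow> complex" where
  "additive_char q n = cis (2 * pi * (of_int n / of_nat q))"

lemma additive_char_sum:
  "additive_char q (\<Sum>x\<in>A. f x) = (\<Prod>x\<in>A. additive_char q (f x))"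
proof (induction A rule: infinite_finite_induct)
  case (insert x A)
  have "additive_char q (m + n) = additive_char q m * additive_char q n" for m n
    unfolding additive_char_def cis_mult of_int_add add_divide_distrib distrib_left ..
  then show ?case using insert by simp
qed (simp_all add: additive_char_def)

lemma additive_char_eq_1_iff:
  assumes "q > 0" shows "additive_char q n = 1 \<longleftrightarrow> int q dvd n"
proof -
  have "additive_char q n = 1 \<longleftrightarrow> (\<exists>m::int. of_int n / of_nat q = (of_int m :: real))"
  proof -
    have "2 * pi * t = of_int (2 * m) * pi \<longleftrightarrow> t = of_int m" for t m by auto
    moreover have "Re (\<i> * complex_of_real t) = 0" "Im (\<i> * complex_of_real t) = t" for t
      by simp_all
    ultimately show ?thesis unfolding additive_char_def cis_conv_exp exp_eq_1 by (simp only: simp_thms)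
  qed
  also have "\<dots> \<longleftrightarrow> (\<exists>m. n = int q * m)"
  proof -
    have "of_int n / of_nat q = (of_int m :: real) \<longleftrightarrow> n = int q * m" for m
    proof -
      have "of_int n / of_nat q = (of_int m :: real) \<longleftrightarrow> real_of_int n = real_of_int (int q * m)"
        using assms by (simp add: field_simps)
      then show ?thesis unfolding of_int_eq_iff .
    qed
    then show ?thesis by simp
  qed
  finally show ?thesis by (simp add: dvd_def)
qed

lemma sum_additive_char:
  assumes "q > 0"
  shows "(\<Sum>a\<in>{0..<int q}. additive_char q (a * c)) = (if int q dvd c then of_nat q else 0)"
proof -
  let ?z = "additive_char q c"
  have pow: "additive_char q (int k * c) = ?z ^ k" for k
    using additive_char_sum[of q "\<lambda>_. c" "{..<k}"] by simp
  have "(\<Sum>a\<in>{0..<int q}. additive_char q (a * c)) = (\<Sum>k<q. additive_char q (int k * c))"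
    by (intro sum.reindex_bij_witness[of _ int nat]) auto
  then have eq: "(\<Sum>a\<in>{0..<int q}. additive_char q (a * c)) = (\<Sum>k<q. ?z ^ k)"
    by (simp add: pow)
  show ?thesis
  proof (cases "int q dvd c")
    case True
    then show ?thesis using eq additive_char_eq_1_iff[OF assms, of c] by simp
  next
    case False
    then have "?z \<noteq> 1" using additive_char_eq_1_iff[OF assms] by simp
    moreover have "?z ^ q = 1"
      unfolding pow[symmetric] using additive_char_eq_1_iff[OF assms] by simp
    ultimately show ?thesis using eq False by (simp add: geometric_sum)
  qed
qed

text \<open>
  Characters separate points: summing over all y tests whether the vector c vanishes modulo q,
  because the sum factors into one geometric sum for every coordinate.
\<close>

lemma sum_additive_char_pairing:
  assumes "finite R" "q > 0"
  shows "(\<Sum>y\<in>R \<rightarrow>\<^sub>E {0..<int q}. additive_char q (\<Sum>r\<in>R. y r * c r)) =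
    (if \<forall>r\<in>R. int q dvd c r then of_nat q ^ card R else 0)"
proof -
  have "(\<Sum>y\<in>R \<rightarrow>\<^sub>E {0..<int q}. additive_char q (\<Sum>r\<in>R. y r * c r)) =
      (\<Prod>r\<in>R. \<Sum>a\<in>{0..<int q}. additive_char q (a * c r))"
    unfolding additive_char_sum using assms by (intro prod_sum_PiE[symmetric]) auto
  also have "\<dots> = (\<Prod>r\<in>R. if int q dvd c r then of_nat q else 0)"
    using assms by (simp add: sum_additive_char)
  also have "\<dots> = (if \<forall>r\<in>R. int q dvd c r then of_nat q ^ card R else 0)"
    using assms by (auto intro: prod_zero)
  finally show ?thesis .
qed

text \<open>
  For prime q this is the equality of row rank and column rank, in a form that avoids linear algebra. Both sides
  equal the sum of \<open>exp (2 \<pi> i y\<^sup>T M x / q)\<close> over all pairs of vectors (x, y): the sum over y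
  picks out the kernel of M, and the sum over x picks out the kernel of the transpose.
\<close>

lemma card_mod_kernel_transpose:
  assumes "finite R" "finite K" "q > 0"
  shows "card (mod_kernel q M R K) * q ^ card R = card (mod_kernel q (\<lambda>k r. M r k) K R) * q ^ card K"
proof -
  have half: "(\<Sum>x\<in>B \<rightarrow>\<^sub>E {0..<int q}. \<Sum>y\<in>A \<rightarrow>\<^sub>E {0..<int q}.
        additive_char q (\<Sum>r\<in>A. y r * (\<Sum>k\<in>B. L r k * x k))) =
      of_nat (card (mod_kernel q L A B) * q ^ card A)"
    if "finite A" "finite B" for A :: "'x set" and B :: "'y set" and L
  proof -
    have fin: "finite (B \<rightarrow>\<^sub>E {0..<int q})" using that by (intro finite_PiE) auto
    have "(\<Sum>x\<in>B \<rightarrow>\<^sub>E {0..<int q}. \<Sum>y\<in>A \<rightarrow>\<^sub>E {0..<int q}.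
        additive_char q (\<Sum>r\<in>A. y r * (\<Sum>k\<in>B. L r k * x k))) =
      (\<Sum>x\<in>B \<rightarrow>\<^sub>E {0..<int q}. if x \<in> mod_kernel q L A B then of_nat q ^ card A else 0)"
      unfolding sum_additive_char_pairing[OF that(1) assms(3)]
      by (intro sum.cong) (auto simp: mod_kernel_def)
    also have "\<dots> = (\<Sum>x\<in>mod_kernel q L A B. of_nat q ^ card A)"
      using Int_absorb1[of "mod_kernel q L A B" "B \<rightarrow>\<^sub>E {0..<int q}"]
      by (subst sum.inter_restrict[OF fin, symmetric]) (auto simp: mod_kernel_def)
    finally show ?thesis by simp
  qed
  have swap: "(\<Sum>r\<in>R. y r * (\<Sum>k\<in>K. M r k * x k)) = (\<Sum>k\<in>K. x k * (\<Sum>r\<in>R. M r k * y r))" for x y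
    unfolding sum_distrib_left by (subst sum.swap) (simp add: mult_ac)
  have "of_nat (card (mod_kernel q M R K) * q ^ card R) =
      (of_nat (card (mod_kernel q (\<lambda>k r. M r k) K R) * q ^ card K) :: complex)"
    unfolding half[OF assms(1,2), symmetric] half[OF assms(2,1), symmetric] swap
    by (rule sum.swap)
  then show ?thesis unfolding of_nat_eq_iff .
qed

text \<open>
  Changing the signs of rows does not change the kernel. Changing the signs of columns is
  compensated by an involution of the vectors. This absorbs the reference orientations of the
  cells and of their duals.
\<close>

lemma card_mod_kernel_sign:
  assumes M': "\<And>r k. r \<in> R \<Longrightarrow> k \<in> K \<Longrightarrow> M' r k = a r * b k * M r k"
    and a: "\<And>r. r \<in> R \<Longrightarrow> a r * a r = 1" and b: "\<And>k. k \<in> K \<Longrightarrow> b k * b k = 1" and "q > 0"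
  shows "card (mod_kernel q M' R K) = card (mod_kernel q M R K)"
proof -
  define \<phi> where "\<phi> g = (\<lambda>k\<in>K. (b k * g k) mod int q)" for g :: "'b \<Rightarrow> int"
  have inv: "\<phi> (\<phi> g) = g" if "g \<in> K \<rightarrow>\<^sub>E {0..<int q}" for g
  proof
    fix k
    show "\<phi> (\<phi> g) k = g k"
    proof (cases "k \<in> K")
      case True
      have "(b k * ((b k * g k) mod int q)) mod int q = (b k * b k * g k) mod int q"
        by (simp add: mod_mult_right_eq mult.assoc)
      then show ?thesis using True b[OF True] PiE_mem[OF that True] by (simp add: \<phi>_def)
    qed (use that in \<open>auto simp: \<phi>_def intro: PiE_arb[symmetric]\<close>)
  qed
  have maps: "\<phi> g \<in> mod_kernel q L' R K"
    if g: "g \<in> mod_kernel q L R K"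
      and L': "\<And>r k. r \<in> R \<Longrightarrow> k \<in> K \<Longrightarrow> L' r k * b k = a r * L r k" for g L L'
  proof -
    have "int q dvd (\<Sum>k\<in>K. L' r k * \<phi> g k)" if "r \<in> R" for r
    proof -
      have "(\<Sum>k\<in>K. L' r k * \<phi> g k) mod int q = (\<Sum>k\<in>K. L' r k * b k * g k) mod int q"
        by (subst (1 2) mod_sum_eq[symmetric]) (simp add: \<phi>_def mod_mult_right_eq mult.assoc)
      also have "(\<Sum>k\<in>K. L' r k * b k * g k) = a r * (\<Sum>k\<in>K. L r k * g k)"
        unfolding sum_distrib_left by (intro sum.cong) (simp_all add: L' that)
      finally have "(\<Sum>k\<in>K. L' r k * \<phi> g k) mod int q = (a r * (\<Sum>k\<in>K. L r k * g k)) mod int q" .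
      moreover have "int q dvd a r * (\<Sum>k\<in>K. L r k * g k)"
        using g that by (simp add: mod_kernel_def)
      ultimately show ?thesis unfolding dvd_eq_mod_eq_0 by (rule trans)
    qed
    moreover have "\<phi> g \<in> K \<rightarrow>\<^sub>E {0..<int q}" using \<open>q > 0\<close> by (auto simp: \<phi>_def)
    ultimately show ?thesis by (simp add: mod_kernel_def)
  qed
  have "bij_betw \<phi> (mod_kernel q M' R K) (mod_kernel q M R K)"
  proof (rule bij_betw_byWitness[where f' = \<phi>])
    show "\<phi> ` mod_kernel q M' R K \<subseteq> mod_kernel q M R K"
    proof (intro image_subsetI maps)
      fix r k assume rk: "r \<in> R" "k \<in> K"
      have "a r * M' r k = (a r * a r) * b k * M r k" using M'[OF rk] by (simp add: mult_ac)
      then show "M r k * b k = a r * M' r k" using a rk by simp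
    qed
    show "\<phi> ` mod_kernel q M R K \<subseteq> mod_kernel q M' R K"
    proof (intro image_subsetI maps)
      fix r k assume rk: "r \<in> R" "k \<in> K"
      have "M' r k * b k = a r * M r k * (b k * b k)" using M'[OF rk] by (simp add: mult_ac)
      then show "M' r k * b k = a r * M r k" using b rk by simp
    qed
  qed (auto simp: mod_kernel_def intro: inv)
  then show ?thesis by (rule bij_betw_same_card)
qed

lemma card_mod_kernel_reindex:
  assumes "inj_on E K"
  shows "card (mod_kernel q M (D ` R) (E ` K)) = card (mod_kernel q (\<lambda>r k. M (D r) (E k)) R K)"
proof (rule bij_betw_same_card)
  show "bij_betw (\<lambda>g. \<lambda>k\<in>K. g (E k)) (mod_kernel q M (D ` R) (E ` K))
      (mod_kernel q (\<lambda>r k. M (D r) (E k)) R K)"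
    by (rule bij_betw_byWitness[where f' = "\<lambda>h. \<lambda>k\<in>E ` K. h (inv_into K E k)"])
      (auto simp: mod_kernel_def sum.reindex[OF assms] assms fun_eq_iff PiE_iff extensional_def)
qed

section \<open>Dual cells of the discrete torus\<close>

lemma face_same_dim_unique:
  assumes "x \<in> cells (shifted_torus d N s)" "face (shifted_torus d N s) y x" "cdim (shifted_torus d N s) y = cdim (shifted_torus d N s) x"
  shows "y = x"
proof -
  have "finite (snd x)"
    using assms(1) by (auto simp: shifted_torus_def shifted_torus_cells_def intro: finite_subset[OF _ finite_lessThan[of d]])
  then have "snd y = snd x"
    using assms(2,3) by (intro card_subset_eq) (auto simp: shifted_torus_def cube_face_def cube_dim_def)
  then show ?thesis
    using assms(2) by (auto simp: shifted_torus_def cube_face_def prod_eq_iff fun_eq_iff)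
qed

text \<open>
  A proper face has smaller dimension, so being closed under faces is automatic for a set of cells
  between two consecutive skeletons. This makes the condition on a percolation subcomplex symmetric
  under complements.
\<close>

lemma percolation_subcomplexes_shifted_torus:
  "percolation_subcomplexes (shifted_torus d N s) j =
     {P. skeleton (shifted_torus d N s) (int j - 1) \<subseteq> P \<and> P \<subseteq> skeleton (shifted_torus d N s) (int j)}"
    (is "?L = ?R")
proof
  show "?L \<subseteq> ?R" by (auto simp: percolation_subcomplexes_def)
  show "?R \<subseteq> ?L"
  proof
    fix P assume P: "P \<in> ?R"
    have "y \<in> P" if "x \<in> P" "y \<in> cells (shifted_torus d N s)" "face (shifted_torus d N s) y x" for x y
    proof (cases "y = x")
      case False
      have x: "x \<in> cells (shifted_torus d N s)" "cdim (shifted_torus d N s) x \<le> j"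
        using P that(1) by (auto simp: skeleton_def)
      have "cdim (shifted_torus d N s) y < cdim (shifted_torus d N s) x"
        using shifted_torus_face_dim[OF x(1) that(3)] face_same_dim_unique[OF x(1) that(3)] False by linarith
      then have "y \<in> skeleton (shifted_torus d N s) (int j - 1)"
        using that(2) x(2) by (simp add: skeleton_def)
      then show ?thesis using P by auto
    qed (use that in simp)
    then show "P \<in> ?L"
      using P by (auto simp: percolation_subcomplexes_def subcomplex_def skeleton_def)
  qed
qed

text \<open>
  The dual cube extends from its least corner in the complementary directions. In a direction of x the
  center of x lies half a lattice step after its least corner, and this is the coordinate of the dual
  cube. In the other directions the dual cube has to start half a step before x. Only there can the
  coordinate wrap around, since even coordinates are at most \<open>2 N - 2\<close>.
\<close>

definition dual_cube :: "nat \<Rightarrow> nat \<Rightarrow> cube \<Rightarrow> cube" where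
  "dual_cube d N x =
     (\<lambda>k\<in>{..<d}. if k \<in> snd x then fst x k + 1 else (fst x k - 1) mod (2 * int N), {..<d} - snd x)"

definition primal_cube :: "nat \<Rightarrow> nat \<Rightarrow> cube \<Rightarrow> cube" where
  "primal_cube d N y =
     (\<lambda>k\<in>{..<d}. if k \<in> snd y then (fst y k + 1) mod (2 * int N) else fst y k - 1, {..<d} - snd y)"

lemma cells_torus_iff:
  "x \<in> cells (torus d N) \<longleftrightarrow>
     fst x \<in> extensional {..<d} \<and> (\<forall>k<d. 0 \<le> fst x k \<and> fst x k < 2 * int N \<and> fst x k mod 2 = 0) \<and>
     snd x \<subseteq> {..<d}"
  by (cases x) (auto simp: torus_def shifted_torus_def shifted_torus_cells_def PiE_iff)

lemma cells_dual_torus_iff: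
  "x \<in> cells (dual_torus d N) \<longleftrightarrow>
     fst x \<in> extensional {..<d} \<and> (\<forall>k<d. 0 \<le> fst x k \<and> fst x k < 2 * int N \<and> fst x k mod 2 = 1) \<and>
     snd x \<subseteq> {..<d}"
  by (cases x) (auto simp: dual_torus_def shifted_torus_def shifted_torus_cells_def PiE_iff)

lemma cyclic_pred:
  assumes "0 \<le> a" "a < 2 * int N"
  shows "(a - 1) mod (2 * int N) = (if a = 0 then 2 * int N - 1 else a - 1)"
proof (cases "a = 0")
  case True
  have "(-1 :: int) mod (2 * int N) = (-1 + 2 * int N) mod (2 * int N)" by simp
  also have "\<dots> = -1 + 2 * int N" using assms True by (intro mod_pos_pos_trivial) auto
  finally show ?thesis using True by simp
qed (use assms in auto)

lemma cyclic_succ: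
  assumes "0 \<le> a" "a < 2 * int N"
  shows "(a + 1) mod (2 * int N) = (if a = 2 * int N - 1 then 0 else a + 1)"
  using assms by auto

lemma cyclic_step:
  assumes "0 \<le> a" "a < 2 * int N"
  shows "step N a = (if a < 2 * int N - 2 then a + 2 else a + 2 - 2 * int N)"
proof (cases "a < 2 * int N - 2")
  case False
  have "(a + 2) mod (2 * int N) = (a + 2 - 2 * int N) mod (2 * int N)" by simp
  also have "\<dots> = a + 2 - 2 * int N"
  proof (rule mod_pos_pos_trivial)
    have "int N \<ge> 1" using assms by linarith
    then show "a + 2 - 2 * int N < 2 * int N" using assms by linarith
  qed (use False in linarith)
  finally show ?thesis using False by (simp add: step_def)
qed (use assms in \<open>auto simp: step_def\<close>)

lemma primal_dual_coordinate:
  assumes "0 \<le> a" "a < 2 * int N" "a mod 2 = 0"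
  shows "a + 1 < 2 * int N" "(a + 1) mod 2 = 1"
    "0 \<le> (a - 1) mod (2 * int N)" "(a - 1) mod (2 * int N) < 2 * int N" "(a - 1) mod (2 * int N) mod 2 = 1"
    "((a - 1) mod (2 * int N) + 1) mod (2 * int N) = a"
proof -
  show *: "a + 1 < 2 * int N" "(a + 1) mod 2 = 1" using assms by presburger+
  show "0 \<le> (a - 1) mod (2 * int N)" "(a - 1) mod (2 * int N) < 2 * int N"
    using assms by auto
  have "(2 * int N - 1) mod 2 = 1" "a \<noteq> 0 \<Longrightarrow> (a - 1) mod 2 = 1" using assms by presburger+
  then show "(a - 1) mod (2 * int N) mod 2 = 1" unfolding cyclic_pred[OF assms(1,2)] by auto
  show "((a - 1) mod (2 * int N) + 1) mod (2 * int N) = a"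
    using assms by (simp add: mod_simps)
qed

lemma dual_primal_coordinate:
  assumes "0 \<le> a" "a < 2 * int N" "a mod 2 = 1"
  shows "0 \<le> a - 1" "(a - 1) mod 2 = 0"
    "0 \<le> (a + 1) mod (2 * int N)" "(a + 1) mod (2 * int N) < 2 * int N" "(a + 1) mod (2 * int N) mod 2 = 0"
    "((a + 1) mod (2 * int N) - 1) mod (2 * int N) = a"
proof -
  show *: "0 \<le> a - 1" "(a - 1) mod 2 = 0" using assms by presburger+
  show "0 \<le> (a + 1) mod (2 * int N)" "(a + 1) mod (2 * int N) < 2 * int N"
    using assms by auto
  have "(a + 1) mod 2 = 0" using assms by presburger
  then show "(a + 1) mod (2 * int N) mod 2 = 0" unfolding cyclic_succ[OF assms(1,2)] by auto
  show "((a + 1) mod (2 * int N) - 1) mod (2 * int N) = a"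
    using assms by (simp add: mod_simps)
qed

lemma dual_cube_cell:
  assumes "x \<in> cells (torus d N)" shows "dual_cube d N x \<in> cells (dual_torus d N)"
  using assms primal_dual_coordinate[of "fst x _" N]
  by (auto simp: cells_torus_iff cells_dual_torus_iff dual_cube_def)

lemma primal_cube_cell:
  assumes "y \<in> cells (dual_torus d N)" shows "primal_cube d N y \<in> cells (torus d N)"
  using assms dual_primal_coordinate[of "fst y _" N]
  by (auto simp: cells_torus_iff cells_dual_torus_iff primal_cube_def)

lemma primal_dual_cube:
  assumes "x \<in> cells (torus d N)" shows "primal_cube d N (dual_cube d N x) = x"
proof (rule prod_eqI)
  show "fst (primal_cube d N (dual_cube d N x)) = fst x"
    using assms primal_dual_coordinate(6)[of "fst x _" N]
    by (intro extensionalityI[of _ "{..<d}"]) (auto simp: cells_torus_iff primal_cube_def dual_cube_def)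
qed (use assms in \<open>auto simp: cells_torus_iff primal_cube_def dual_cube_def\<close>)

lemma dual_primal_cube:
  assumes "y \<in> cells (dual_torus d N)" shows "dual_cube d N (primal_cube d N y) = y"
proof (rule prod_eqI)
  show "fst (dual_cube d N (primal_cube d N y)) = fst y"
    using assms dual_primal_coordinate(6)[of "fst y _" N]
    by (intro extensionalityI[of _ "{..<d}"]) (auto simp: cells_dual_torus_iff primal_cube_def dual_cube_def)
qed (use assms in \<open>auto simp: cells_dual_torus_iff primal_cube_def dual_cube_def\<close>)

lemma bij_betw_dual_cube: "bij_betw (dual_cube d N) (cells (torus d N)) (cells (dual_torus d N))"
  by (rule bij_betw_byWitness[where f' = "primal_cube d N"])
    (auto simp: primal_dual_cube dual_primal_cube dual_cube_cell primal_cube_cell)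

lemma card_directions_le: "x \<in> cells (torus d N) \<Longrightarrow> cube_dim x \<le> d"
  using card_mono[of "{..<d}" "snd x"] by (auto simp: cells_torus_iff cube_dim_def)

lemma cube_dim_dual_cube:
  assumes "x \<in> cells (torus d N)" shows "cube_dim (dual_cube d N x) = d - cube_dim x"
  using assms finite_subset[of "snd x" "{..<d}"]
  by (auto simp: cells_torus_iff cube_dim_def dual_cube_def card_Diff_subset)

lemma cdim_torus [simp]: "cdim (torus d N) = cube_dim" "cdim (dual_torus d N) = cube_dim"
  by (simp_all add: torus_def dual_torus_def shifted_torus_def)

lemma dual_cell_eq_dual_cube:
  assumes x: "x \<in> cells (torus d N)" shows "dual_cell d N x = dual_cube d N x"
proof -
  have "center d N (dual_cube d N x) = center d N x"
    using x by (auto simp: center_def dual_cube_def fun_eq_iff mod_simps)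
  then show ?thesis
    unfolding dual_cell_def using ex1_dual_cell[OF x] dual_cube_cell[OF x] cube_dim_dual_cube[OF x]
    by (intro the1_equality) (auto simp: jcells_def)
qed

lemma dual_subcomplex_eq: "dual_subcomplex d N P = dual_cube d N ` (cells (torus d N) - P)"
proof -
  have "dual_subcomplex d N P = dual_cell d N ` (cells (torus d N) - P)"
    unfolding dual_subcomplex_def by blast
  also have "\<dots> = dual_cube d N ` (cells (torus d N) - P)"
    by (intro image_cong) (simp_all add: dual_cell_eq_dual_cube)
  finally show ?thesis .
qed

lemma dual_subcomplex_jcells:
  assumes "j \<le> d"
  shows "dual_subcomplex d N P \<inter> jcells (dual_torus d N) (d - j) = dual_cube d N ` (jcells (torus d N) j - P)"
proof -
  have "d - cube_dim x = d - j \<longleftrightarrow> cube_dim x = j" if "x \<in> cells (torus d N)" for x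
    using card_directions_le[OF that] assms by linarith
  then show ?thesis
    unfolding dual_subcomplex_eq jcells_def
    by (auto simp: dual_cube_cell cube_dim_dual_cube)
qed

lemma jcells_dual_torus:
  assumes "j \<le> d"
  shows "jcells (dual_torus d N) (d - j) = dual_cube d N ` jcells (torus d N) j"
proof -
  have "dual_subcomplex d N {} = cells (dual_torus d N)"
    using bij_betw_dual_cube[of d N] by (simp add: dual_subcomplex_eq bij_betw_def)
  then show ?thesis using dual_subcomplex_jcells[OF assms, of N "{}"] by (auto simp: jcells_def)
qed

text \<open>
  A percolation subcomplex contains every cell of smaller dimension than j, none of larger dimension,
  and an arbitrary set of j-cells. Taking complements and dual cells preserves this description, with j
  replaced by \<open>d - j\<close>.
\<close>

lemma bij_betw_dual_subcomplex:
  assumes "j \<le> d"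
  shows "bij_betw (dual_subcomplex d N) (percolation_subcomplexes (torus d N) j)
    (percolation_subcomplexes (dual_torus d N) (d - j))"
proof -
  let ?T = "cells (torus d N)" and ?D = "dual_cube d N"
  note bij = bij_betw_dual_cube[of d N]
  have dim: "int (cube_dim (?D x)) = int d - int (cube_dim x)" if "x \<in> ?T" for x
    using card_directions_le[OF that] cube_dim_dual_cube[OF that] by simp
  have primal: "P \<in> percolation_subcomplexes (torus d N) j \<longleftrightarrow>
      P \<subseteq> ?T \<and> (\<forall>x\<in>?T. (cube_dim x < j \<longrightarrow> x \<in> P) \<and> (x \<in> P \<longrightarrow> cube_dim x \<le> j))" for P
    unfolding torus_def percolation_subcomplexes_shifted_torus
    unfolding torus_def[symmetric] skeleton_def by auto
  have dual: "Q \<in> percolation_subcomplexes (dual_torus d N) (d - j) \<longleftrightarrow>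
      Q \<subseteq> ?D ` ?T \<and> (\<forall>x\<in>?T. (j < cube_dim x \<longrightarrow> ?D x \<in> Q) \<and> (?D x \<in> Q \<longrightarrow> j \<le> cube_dim x))" for Q
  proof -
    have "Q \<in> percolation_subcomplexes (dual_torus d N) (d - j) \<longleftrightarrow>
      Q \<subseteq> ?D ` ?T \<and> (\<forall>y\<in>?D ` ?T. (int (cube_dim y) \<le> int (d - j) - 1 \<longrightarrow> y \<in> Q) \<and>
        (y \<in> Q \<longrightarrow> int (cube_dim y) \<le> int (d - j)))"
      unfolding dual_torus_def percolation_subcomplexes_shifted_torus
      unfolding dual_torus_def[symmetric] skeleton_def bij_betw_imp_surj_on[OF bij] by auto
    also have "\<dots> \<longleftrightarrow>
      Q \<subseteq> ?D ` ?T \<and> (\<forall>x\<in>?T. (j < cube_dim x \<longrightarrow> ?D x \<in> Q) \<and> (?D x \<in> Q \<longrightarrow> j \<le> cube_dim x))"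
      using assms by (simp add: dim of_nat_diff)
    finally show ?thesis .
  qed
  have mem: "?D x \<in> dual_subcomplex d N P \<longleftrightarrow> x \<notin> P" if "x \<in> ?T" for x P
    unfolding dual_subcomplex_eq using that bij_betw_imp_inj_on[OF bij] by (auto dest: inj_onD)
  show ?thesis
  proof (rule bij_betw_byWitness[where f' = "\<lambda>Q. {x \<in> ?T. ?D x \<notin> Q}"])
    show "\<forall>P\<in>percolation_subcomplexes (torus d N) j. {x \<in> ?T. ?D x \<notin> dual_subcomplex d N P} = P"
    proof
      fix P assume "P \<in> percolation_subcomplexes (torus d N) j"
      then have "P \<subseteq> ?T" unfolding primal by blast
      then show "{x \<in> ?T. ?D x \<notin> dual_subcomplex d N P} = P" using mem by blast
    qed
    show "\<forall>Q\<in>percolation_subcomplexes (dual_torus d N) (d - j). dual_subcomplex d N {x \<in> ?T. ?D x \<notin> Q} = Q"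
    proof
      fix Q assume "Q \<in> percolation_subcomplexes (dual_torus d N) (d - j)"
      then have "Q \<subseteq> ?D ` ?T" unfolding dual by blast
      then show "dual_subcomplex d N {x \<in> ?T. ?D x \<notin> Q} = Q" unfolding dual_subcomplex_eq by blast
    qed
    show "dual_subcomplex d N ` percolation_subcomplexes (torus d N) j
        \<subseteq> percolation_subcomplexes (dual_torus d N) (d - j)"
    proof (intro image_subsetI)
      fix P assume "P \<in> percolation_subcomplexes (torus d N) j"
      then show "dual_subcomplex d N P \<in> percolation_subcomplexes (dual_torus d N) (d - j)"
        unfolding primal dual by (auto simp: mem) (auto simp: dual_subcomplex_eq not_le)
    qed
    show "(\<lambda>Q. {x \<in> ?T. ?D x \<notin> Q}) ` percolation_subcomplexes (dual_torus d N) (d - j)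
        \<subseteq> percolation_subcomplexes (torus d N) j"
    proof (intro image_subsetI)
      fix Q assume "Q \<in> percolation_subcomplexes (dual_torus d N) (d - j)"
      then show "{x \<in> ?T. ?D x \<notin> Q} \<in> percolation_subcomplexes (torus d N) j"
        unfolding primal dual by (auto simp: not_le[symmetric])
    qed
  qed
qed

lemma extensional_eq_iff:
  assumes "f \<in> extensional A" "g \<in> extensional A"
  shows "f = g \<longleftrightarrow> (\<forall>a\<in>A. f a = g a)"
  using assms by (auto intro: extensionalityI)

text \<open>
  The two lemmas below say in one coordinate that passing from a cell to its dual exchanges front and
  back: the half step after a is the half step before b precisely if b is one lattice step after a,
  and it is one lattice step after the half step before b precisely if \<open>b = a\<close>. Parity ensures
  that \<open>a + 1\<close> does not wrap around.
\<close>

lemma half_step_pred: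
  assumes "0 \<le> a" "a < 2 * int N" "a mod 2 = 0" "0 \<le> b" "b < 2 * int N" "b mod 2 = 0"
  shows "a + 1 = (if b = 0 then 2 * int N - 1 else b - 1) \<longleftrightarrow> b = step N a"
proof -
  obtain a' b' where "a = 2 * a'" "b = 2 * b'" using assms(3,6) by (meson mod_0_imp_dvd dvdE)
  then show ?thesis using assms unfolding cyclic_step[OF assms(1,2)]
    by (cases "b = 0"; cases "a < 2 * int N - 2") (simp_all, linarith+)
qed

lemma half_step_succ:
  assumes "0 \<le> a" "a < 2 * int N" "a mod 2 = 0" "0 \<le> b" "b < 2 * int N" "b mod 2 = 0"
  shows "a + 1 = step N (if b = 0 then 2 * int N - 1 else b - 1) \<longleftrightarrow> b = a"
proof (cases "b = 0")
  case True
  then have "step N (2 * int N - 1) = 1" using assms by (subst cyclic_step) auto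
  then show ?thesis using True by auto
next
  case False
  then have "step N (b - 1) = b + 1"
    using assms primal_dual_coordinate(1)[OF assms(4-6)] by (subst cyclic_step) auto
  then show ?thesis using False by auto
qed

text \<open>
  The displacement from the center of x to the center of its face y is reversed when seen from the
  dual of y, of which the dual of x is a face. Hence back faces correspond to front faces. Both
  equivalences are needed separately, because for \<open>N = 1\<close> the two faces in a direction coincide.
\<close>

lemma dual_front_face_iff:
  assumes x: "x \<in> cells (torus d N)" and y: "y \<in> cells (torus d N)" and k: "k \<in> snd x" "k \<notin> snd y"
  shows "dual_cube d N x = front_face (dual_cube d N y) k \<longleftrightarrow> y = back_face N x k"
    "dual_cube d N x = back_face N (dual_cube d N y) k \<longleftrightarrow> y = front_face x k"
proof -
  have kd: "k < d" using x k by (auto simp: cells_torus_iff)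
  let ?X = "dual_cube d N x" and ?Y = "dual_cube d N y"
  have dirs: "{..<d} - snd x = {..<d} - snd y - {k} \<longleftrightarrow> snd y = snd x - {k}"
    using x y k by (auto simp: cells_torus_iff)
  have other: "fst ?X l = fst ?Y l \<longleftrightarrow> fst y l = fst x l" if "snd y = snd x - {k}" "l < d" "l \<noteq> k" for l
  proof -
    have "0 \<le> fst x l" "fst x l < 2 * int N" "0 \<le> fst y l" "fst y l < 2 * int N"
      using x y that by (auto simp: cells_torus_iff)
    moreover have "l \<in> snd y \<longleftrightarrow> l \<in> snd x" using that by auto
    ultimately show ?thesis
      using that(2) by (cases "l \<in> snd x") (simp_all add: dual_cube_def cyclic_pred, auto)
  qed
  have r: "0 \<le> fst x k" "fst x k < 2 * int N" "0 \<le> fst y k" "fst y k < 2 * int N"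
    and par: "fst x k mod 2 = 0" "fst y k mod 2 = 0"
    using x y kd by (auto simp: cells_torus_iff)
  have X: "fst ?X k = fst x k + 1" and Y: "fst ?Y k = (if fst y k = 0 then 2 * int N - 1 else fst y k - 1)"
    using k kd r by (auto simp: dual_cube_def cyclic_pred)
  have at1: "fst ?X k = fst ?Y k \<longleftrightarrow> fst y k = step N (fst x k)"
    unfolding X Y using half_step_pred[OF r(1,2) par(1) r(3,4) par(2)] .
  have at2: "fst ?X k = step N (fst ?Y k) \<longleftrightarrow> fst y k = fst x k"
    unfolding X Y using half_step_succ[OF r(1,2) par(1) r(3,4) par(2)] .
  have ext: "fst x \<in> extensional {..<d}" "fst y \<in> extensional {..<d}"
    "fst ?X \<in> extensional {..<d}" "fst ?Y \<in> extensional {..<d}"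
    using x y by (auto simp: cells_torus_iff dual_cube_def)
  have ext_upd: "f(k := a) \<in> extensional {..<d}" if "f \<in> extensional {..<d}" for f and a :: int
    using that kd by (auto simp: extensional_def)
  have snds: "snd ?X = {..<d} - snd x" "snd ?Y = {..<d} - snd y" by (simp_all add: dual_cube_def)
  show "?X = front_face ?Y k \<longleftrightarrow> y = back_face N x k"
  proof (cases "snd y = snd x - {k}")
    case True
    have "?X = front_face ?Y k \<longleftrightarrow> (\<forall>l\<in>{..<d}. fst ?X l = fst ?Y l)"
      using True dirs by (simp add: front_face_def prod_eq_iff snds extensional_eq_iff[OF ext(3,4)])
    also have "\<dots> \<longleftrightarrow> (\<forall>l\<in>{..<d}. fst y l = ((fst x)(k := step N (fst x k))) l)"
      using other[OF True] at1 by (intro ball_cong) auto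
    also have "\<dots> \<longleftrightarrow> y = back_face N x k"
      using True by (simp only: back_face_def prod_eq_iff fst_conv snd_conv simp_thms
          extensional_eq_iff[OF ext(2) ext_upd[OF ext(1)]])
    finally show ?thesis .
  next
    case False
    then show ?thesis using dirs by (auto simp: front_face_def back_face_def prod_eq_iff snds)
  qed
  show "?X = back_face N ?Y k \<longleftrightarrow> y = front_face x k"
  proof (cases "snd y = snd x - {k}")
    case True
    have "?X = back_face N ?Y k \<longleftrightarrow> (\<forall>l\<in>{..<d}. fst ?X l = ((fst ?Y)(k := step N (fst ?Y k))) l)"
      using True dirs by (simp only: back_face_def prod_eq_iff snds fst_conv snd_conv simp_thms
          extensional_eq_iff[OF ext(3) ext_upd[OF ext(4)]])
    also have "\<dots> \<longleftrightarrow> (\<forall>l\<in>{..<d}. fst y l = fst x l)"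
      using other[OF True] at2 by (intro ball_cong) auto
    also have "\<dots> \<longleftrightarrow> y = front_face x k"
      using True by (simp add: front_face_def prod_eq_iff extensional_eq_iff[OF ext(2,1)])
    finally show ?thesis .
  next
    case False
    then show ?thesis using dirs by (auto simp: front_face_def back_face_def prod_eq_iff snds)
  qed
qed

text \<open>
  These signs relate the reference orientations of the cells and of their duals in such a way that the
  incidence numbers agree up to a global sign.
\<close>

definition direction_sign :: "cube \<Rightarrow> int" where
  "direction_sign x = (-1) ^ (\<Sum>(snd x))"

text \<open>
  If y is a face of x in direction k, then the directions below k are either directions of x or
  directions of the dual of y. So the two orientation signs multiply to \<open>(-1) ^ k\<close>. Since k is the
  only direction of x which is missing in y, this is the product of the direction signs of x and y.
  The remaining minus sign comes from the exchange of front and back.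
\<close>

lemma cube_inc_dual_cube:
  assumes x: "x \<in> cells (torus d N)" and y: "y \<in> cells (torus d N)"
  shows "cube_inc N (dual_cube d N y) (dual_cube d N x) =
    - direction_sign x * direction_sign y * cube_inc N x y"
proof -
  let ?X = "dual_cube d N x" and ?Y = "dual_cube d N y"
  define t where "t u v k = (-1) ^ card {l \<in> snd u. l < k} *
        (of_bool (v = back_face N u k) - of_bool (v = front_face u k) :: int)" for u v k
  have S: "snd x \<subseteq> {..<d}" "snd y \<subseteq> {..<d}" using x y by (auto simp: cells_torus_iff)
  have fin: "finite (snd x)" "finite (snd y)" using S by (auto intro: finite_subset)
  have snds: "snd ?X = {..<d} - snd x" "snd ?Y = {..<d} - snd y" by (simp_all add: dual_cube_def)
  have t0: "t u v k = 0" if "k \<in> snd v" for u v k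
    using that by (auto simp: t_def back_face_def front_face_def)
  have inc: "cube_inc N u v = (\<Sum>k\<in>snd u - snd v. t u v k)" if "finite (snd u)" for u v
    unfolding cube_inc_def t_def[symmetric] using that by (intro sum.mono_neutral_right) (auto simp: t0)
  have idx: "snd ?Y - snd ?X = snd x - snd y" using S by (auto simp: snds)
  have "t ?Y ?X k = - direction_sign x * direction_sign y * t x y k" if k: "k \<in> snd x - snd y" for k
  proof (cases "snd y = snd x - {k}")
    case True
    have kS: "k \<in> snd x" "k \<notin> snd y" using k by auto
    have "{..<k} = {l \<in> snd x. l < k} \<union> {l \<in> snd ?Y. l < k}"
      using True S kS by (auto simp: snds)
    moreover have "card ({l \<in> snd x. l < k} \<union> {l \<in> snd ?Y. l < k}) =
        card {l \<in> snd x. l < k} + card {l \<in> snd ?Y. l < k}"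
      by (rule card_Un_disjoint) (use True in \<open>auto simp: snds\<close>)
    ultimately have "k = card {l \<in> snd x. l < k} + card {l \<in> snd ?Y. l < k}"
      by (metis card_lessThan)
    then have par: "(-1 :: int) ^ k = (-1) ^ card {l \<in> snd x. l < k} * (-1) ^ card {l \<in> snd ?Y. l < k}"
      by (metis power_add)
    have "\<Sum>(snd x) = k + \<Sum>(snd y)" using True fin kS by (simp add: sum.remove)
    then have ds: "direction_sign x * direction_sign y = (-1) ^ k"
      by (simp add: direction_sign_def power_add mult.assoc flip: power_mult_distrib)
    have sq: "(-1 :: int) ^ n * ((-1) ^ n * a) = a" for n a
      by (simp flip: mult.assoc power_mult_distrib)
    have "t ?Y ?X k = (-1) ^ card {l \<in> snd ?Y. l < k} *
        (of_bool (y = front_face x k) - of_bool (y = back_face N x k))"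
      unfolding t_def dual_front_face_iff[OF x y kS] ..
    also have "\<dots> = - ((-1) ^ k) * t x y k"
      unfolding par t_def by (simp add: sq algebra_simps)
    also have "\<dots> = - direction_sign x * direction_sign y * t x y k"
      unfolding ds[symmetric] by simp
    finally show ?thesis .
  next
    case False
    have kS: "k \<in> snd x" "k \<notin> snd y" using k by auto
    have "t x y k = 0" using False by (auto simp: t_def back_face_def front_face_def)
    moreover have "t ?Y ?X k = 0"
      unfolding t_def dual_front_face_iff[OF x y kS] using False
      by (auto simp: back_face_def front_face_def)
    ultimately show ?thesis by simp
  qed
  then have "(\<Sum>k\<in>snd x - snd y. t ?Y ?X k) = - direction_sign x * direction_sign y * (\<Sum>k\<in>snd x - snd y. t x y k)"
    unfolding sum_distrib_left by (intro sum.cong) auto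
  moreover have "finite (snd ?Y)" by (simp add: snds)
  ultimately show ?thesis using inc[OF fin(1), of y] inc[of ?Y ?X] idx by simp
qed

section \<open>Duality of relative cohomology\<close>

lemma coboundary_vanishes_iff:
  assumes "finite (cells X)" and f: "\<And>y. y \<in> P1 \<inter> jcells X i \<Longrightarrow> f (y, True) = 0"
  shows "(\<forall>\<sigma>\<in>oriented_cells X P2 (i + 1). coboundary q X (cells X) i f \<sigma> = 0) \<longleftrightarrow>
    (\<forall>x\<in>P2 \<inter> jcells X (i + 1). int q dvd (\<Sum>y\<in>jcells X i - P1. inc X x y * f (y, True)))"
proof -
  have fin: "finite (jcells X i)" using assms(1) by (simp add: jcells_def)
  have cells: "cells X \<inter> jcells X j = jcells X j" for j by (auto simp: jcells_def)
  have cob: "coboundary q X (cells X) i f (x, s) = 0 \<longleftrightarrow>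
      int q dvd (\<Sum>y\<in>jcells X i - P1. inc X x y * f (y, True))"
    if x: "x \<in> jcells X (i + 1)" for x s
  proof -
    have "coboundary q X (cells X) i f (x, s) =
        (\<Sum>y\<in>jcells X i. boundary_coeff X (x, s) y * f (y, True)) mod int q"
      using x by (simp add: coboundary_def oriented_cells_def cells)
    also have "(\<Sum>y\<in>jcells X i. boundary_coeff X (x, s) y * f (y, True)) =
        (\<Sum>y\<in>jcells X i - P1. boundary_coeff X (x, s) y * f (y, True))"
      using fin f by (intro sum.mono_neutral_right) auto
    also have "\<dots> = (if s then 1 else -1) * (\<Sum>y\<in>jcells X i - P1. inc X x y * f (y, True))"
      by (simp add: boundary_coeff_def sum_negf)
    finally show ?thesis by (simp add: dvd_eq_mod_eq_0[symmetric])
  qed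
  show ?thesis using cob by (force simp: oriented_cells_def)
qed

text \<open>
  A cochain is determined by its values on the reference orientations, and on \<open>P1\<close> it vanishes. So
  the relative cohomology is the kernel of the incidence matrix whose rows are the (i+1)-cells of \<open>P2\<close>
  and whose columns are the i-cells outside \<open>P1\<close>.
\<close>

lemma card_relative_cohomology_mod_kernel:
  assumes fin: "finite (cells X)" and "q > 0"
    and P: "P2 \<in> percolation_subcomplexes X (i + 1)" "P1 \<in> percolation_subcomplexes X i"
  shows "card (relative_cohomology q X P2 P1 i) =
    card (mod_kernel q (inc X) (P2 \<inter> jcells X (i + 1)) (jcells X i - P1))"
  unfolding card_relative_cohomology[OF assms(2) P]
proof (rule bij_betw_same_card)
  let ?K = "jcells X i - P1" and ?R = "P2 \<inter> jcells X (i + 1)" and ?O = "oriented_cells X (cells X) i"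
  define G where "G = {f \<in> cochains q X (cells X) i.
      (\<forall>\<sigma>\<in>oriented_cells X P1 i. f \<sigma> = 0) \<and>
      (\<forall>\<sigma>\<in>oriented_cells X P2 (i + 1). coboundary q X (cells X) i f \<sigma> = 0)}"
  define \<phi> where "\<phi> f = (\<lambda>y\<in>?K. f (y, True))" for f :: "'a \<times> bool \<Rightarrow> int"
  define \<psi> where "\<psi> g = (\<lambda>\<sigma>\<in>?O. if fst \<sigma> \<in> P1 then 0
      else if snd \<sigma> then g (fst \<sigma>) else (- g (fst \<sigma>)) mod int q)" for g :: "'a \<Rightarrow> int"
  have O_eq: "?O = jcells X i \<times> UNIV" by (auto simp: oriented_cells_def jcells_def)
  then have O: "(y, s) \<in> ?O \<longleftrightarrow> y \<in> jcells X i" for y s by simp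
  have O1: "(y, s) \<in> oriented_cells X P1 i \<longleftrightarrow> y \<in> P1 \<inter> jcells X i" for y s
    by (auto simp: oriented_cells_def)
  have cochain: "f \<in> cochains q X (cells X) i \<longleftrightarrow> f \<in> ?O \<rightarrow>\<^sub>E {0..<int q} \<and>
      (\<forall>y\<in>jcells X i. \<forall>s. f (y, \<not> s) = (- f (y, s)) mod int q)" for f
    by (auto simp: cochains_def reverse_def O_eq)
  have neg: "(- ((- a) mod int q)) mod int q = a mod int q" for a :: int
    by (simp add: mod_minus_eq)
  have "bij_betw \<phi> G (mod_kernel q (inc X) ?R ?K)"
  proof (rule bij_betw_byWitness[where f' = \<psi>])
    show "\<forall>f\<in>G. \<psi> (\<phi> f) = f"
    proof
      fix f assume f: "f \<in> G"
      have "\<psi> (\<phi> f) (y, s) = f (y, s)" for y s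
      proof (cases "y \<in> jcells X i")
        case True
        then have "f (y, \<not> True) = (- f (y, True)) mod int q"
          using f unfolding G_def cochain by blast
        moreover have "y \<in> P1 \<Longrightarrow> f (y, s) = 0"
          using f True by (auto simp: G_def O1)
        ultimately show ?thesis using True by (cases s) (auto simp: \<psi>_def \<phi>_def O)
      next
        case False
        then have "(y, s) \<notin> ?O" using O by simp
        moreover have "f \<in> ?O \<rightarrow>\<^sub>E {0..<int q}" using f unfolding G_def cochain by blast
        ultimately show ?thesis using PiE_arb[of f] by (simp add: \<psi>_def)
      qed
      then show "\<psi> (\<phi> f) = f" by (simp add: fun_eq_iff)
    qed
    show "\<forall>g\<in>mod_kernel q (inc X) ?R ?K. \<phi> (\<psi> g) = g"
    proof
      fix g assume "g \<in> mod_kernel q (inc X) ?R ?K"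
      then show "\<phi> (\<psi> g) = g"
        by (intro extensionalityI[of _ ?K]) (auto simp: \<psi>_def \<phi>_def O mod_kernel_def PiE_iff)
    qed
    show "\<phi> ` G \<subseteq> mod_kernel q (inc X) ?R ?K"
    proof (intro image_subsetI)
      fix f assume f: "f \<in> G"
      then have "f (y, True) = 0" if "y \<in> P1 \<inter> jcells X i" for y
        using that O1 by (auto simp: G_def)
      then have "\<forall>x\<in>?R. int q dvd (\<Sum>y\<in>?K. inc X x y * f (y, True))"
        using coboundary_vanishes_iff[of X P1 i f P2 q] fin f by (simp add: G_def)
      moreover have "f (y, True) \<in> {0..<int q}" if "y \<in> jcells X i" for y
        using f that O unfolding G_def cochain by blast
      ultimately show "\<phi> f \<in> mod_kernel q (inc X) ?R ?K"
        by (auto simp: mod_kernel_def \<phi>_def)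
    qed
    show "\<psi> ` mod_kernel q (inc X) ?R ?K \<subseteq> G"
    proof (intro image_subsetI)
      fix g assume g: "g \<in> mod_kernel q (inc X) ?R ?K"
      have gr: "0 \<le> g y" "g y < int q" if "y \<in> jcells X i" "y \<notin> P1" for y
        using g that by (auto simp: mod_kernel_def PiE_iff)
      have val: "\<psi> g (y, s) = (if y \<in> P1 then 0 else if s then g y else (- g y) mod int q)"
        if "y \<in> jcells X i" for y s using that by (simp add: \<psi>_def O)
      have "\<psi> g \<in> cochains q X (cells X) i"
        unfolding cochain
      proof
        show "\<psi> g \<in> ?O \<rightarrow>\<^sub>E {0..<int q}"
          using gr \<open>q > 0\<close> by (auto simp: \<psi>_def PiE_iff O)
        show "\<forall>y\<in>jcells X i. \<forall>s. \<psi> g (y, \<not> s) = (- \<psi> g (y, s)) mod int q"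
          using gr by (auto simp: val neg)
      qed
      moreover have "\<forall>\<sigma>\<in>oriented_cells X P1 i. \<psi> g \<sigma> = 0"
        by (auto simp: O1 val)
      moreover have "\<forall>\<sigma>\<in>oriented_cells X P2 (i + 1). coboundary q X (cells X) i (\<psi> g) \<sigma> = 0"
      proof -
        have "\<psi> g (y, True) = 0" if "y \<in> P1 \<inter> jcells X i" for y
          using that by (simp add: val)
        moreover have "(\<Sum>y\<in>?K. inc X x y * \<psi> g (y, True)) = (\<Sum>y\<in>?K. inc X x y * g y)" for x
          by (intro sum.cong) (auto simp: val)
        ultimately show ?thesis
          using coboundary_vanishes_iff[of X P1 i "\<psi> g" P2 q] fin g
          by (simp add: mod_kernel_def)
      qed
      ultimately show "\<psi> g \<in> G" by (simp add: G_def)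
    qed
  qed
  then show "bij_betw \<phi> {f \<in> cochains q X (cells X) i.
      (\<forall>\<sigma>\<in>oriented_cells X P1 i. f \<sigma> = 0) \<and>
      (\<forall>\<sigma>\<in>oriented_cells X P2 (i + 1). coboundary q X (cells X) i f \<sigma> = 0)}
      (mod_kernel q (inc X) ?R ?K)"
    unfolding G_def .
qed

lemma finite_torus: "finite (cells (torus d N))" "finite (cells (dual_torus d N))"
  unfolding torus_def dual_torus_def by (rule finite_shifted_torus)+

lemma inc_torus [simp]: "inc (torus d N) = cube_inc N" "inc (dual_torus d N) = cube_inc N"
  by (simp_all add: torus_def dual_torus_def shifted_torus_def)

text \<open>
  Under duality the (i+1)-cells of \<open>P2\<close> become the cells on which dual cochains may be non-zero,
  and the i-cells outside \<open>P1\<close> become the cells on which their coboundaries have to vanish. So rows and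
  columns of the incidence matrix change places, and the kernels are compared by transposition.
\<close>

lemma card_relative_cohomology_dual:
  assumes "q > 0" "i < d"
    and P: "P2 \<in> percolation_subcomplexes (torus d N) (i + 1)" "P1 \<in> percolation_subcomplexes (torus d N) i"
  shows "card (relative_cohomology q (torus d N) P2 P1 i) * q ^ card (P2 \<inter> jcells (torus d N) (i + 1)) =
    card (relative_cohomology q (dual_torus d N) (dual_subcomplex d N P1) (dual_subcomplex d N P2) (d - i - 1))
      * q ^ card (jcells (torus d N) i - P1)"
proof -
  let ?T = "torus d N" and ?T' = "dual_torus d N" and ?D = "dual_cube d N"
  let ?R = "P2 \<inter> jcells ?T (i + 1)" and ?K = "jcells ?T i - P1"
  note inj = bij_betw_imp_inj_on[OF bij_betw_dual_cube[of d N]]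
  have fin: "finite ?R" "finite ?K" using finite_torus by (auto simp: jcells_def)
  have sub: "?R \<subseteq> cells ?T" "?K \<subseteq> cells ?T" by (auto simp: jcells_def)
  have dims: "d - i - 1 + 1 = d - i" "d - i - 1 = d - (i + 1)" "i \<le> d" "i + 1 \<le> d" using assms by auto
  have dual_P: "dual_subcomplex d N P1 \<in> percolation_subcomplexes ?T' (d - i - 1 + 1)"
    "dual_subcomplex d N P2 \<in> percolation_subcomplexes ?T' (d - i - 1)"
    unfolding dims(1) unfolding dims(2)
    using bij_betw_imp_surj_on[OF bij_betw_dual_subcomplex[OF dims(3)]]
      bij_betw_imp_surj_on[OF bij_betw_dual_subcomplex[OF dims(4)]] P by blast+
  have rows: "dual_subcomplex d N P1 \<inter> jcells ?T' (d - i - 1 + 1) = ?D ` ?K"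
    unfolding dims(1) by (rule dual_subcomplex_jcells[OF dims(3)])
  have cols: "jcells ?T' (d - i - 1) - dual_subcomplex d N P2 = ?D ` ?R"
  proof -
    have "jcells ?T' (d - i - 1) - dual_subcomplex d N P2 =
        ?D ` jcells ?T (i + 1) - (dual_subcomplex d N P2 \<inter> jcells ?T' (d - (i + 1)))"
      unfolding dims(2) jcells_dual_torus[OF dims(4)] by blast
    also have "\<dots> = ?D ` (jcells ?T (i + 1) - (jcells ?T (i + 1) - P2))"
      unfolding dual_subcomplex_jcells[OF dims(4)]
      by (rule inj_on_image_set_diff[OF inj, symmetric]) (auto simp: jcells_def)
    finally show ?thesis by (simp add: Diff_Diff_Int Int_commute)
  qed
  have "card (relative_cohomology q ?T' (dual_subcomplex d N P1) (dual_subcomplex d N P2) (d - i - 1)) =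
      card (mod_kernel q (cube_inc N) (?D ` ?K) (?D ` ?R))"
    unfolding card_relative_cohomology_mod_kernel[OF finite_torus(2) assms(1) dual_P] rows cols by simp
  also have "\<dots> = card (mod_kernel q (\<lambda>y x. cube_inc N (?D y) (?D x)) ?K ?R)"
    by (rule card_mod_kernel_reindex) (rule inj_on_subset[OF inj sub(1)])
  also have "\<dots> = card (mod_kernel q (\<lambda>y x. cube_inc N x y) ?K ?R)"
  proof (rule card_mod_kernel_sign[where a = "\<lambda>y. - direction_sign y" and b = direction_sign])
    show "cube_inc N (?D y) (?D x) = - direction_sign y * direction_sign x * cube_inc N x y"
      if "y \<in> ?K" "x \<in> ?R" for y x
      using cube_inc_dual_cube[of x d N y] that sub by (auto simp: mult_ac)
  qed (use assms in \<open>simp_all add: direction_sign_def flip: power_mult_distrib\<close>)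
  finally have dual: "card (relative_cohomology q ?T' (dual_subcomplex d N P1) (dual_subcomplex d N P2) (d - i - 1)) =
      card (mod_kernel q (\<lambda>y x. cube_inc N x y) ?K ?R)" .
  show ?thesis
    unfolding dual card_relative_cohomology_mod_kernel[OF finite_torus(1) assms(1) P] inc_torus
    by (rule card_mod_kernel_transpose[OF fin assms(1)])
qed

section \<open>Duality of the measures\<close>

lemma dual_parameter:
  fixes p p' Q :: real
  assumes "p \<in> {0..1}" "Q > 0" "p' = Q * (1 - p) / (p + Q * (1 - p))"
  shows "p + Q * (1 - p) > 0" "1 - p' = p / (p + Q * (1 - p))" "p' \<in> {0..1}"
proof -
  show *: "p + Q * (1 - p) > 0"
  proof (cases "p = 0")
    case False
    then show ?thesis using assms by (intro add_pos_nonneg) auto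
  qed (use assms in simp)
  show eq: "1 - p' = p / (p + Q * (1 - p))" unfolding assms(3) using * by (simp add: field_simps)
  have "0 \<le> p'" unfolding assms(3) using assms(1,2) * by (intro divide_nonneg_pos) auto
  moreover have "0 \<le> 1 - p'" unfolding eq using assms(1) * by (intro divide_nonneg_pos) auto
  ultimately show "p' \<in> {0..1}" by simp
qed

text \<open>
  The dual parameters are chosen so that the odds become \<open>p2' / (1 - p2') = q (1 - p1) / p1\<close> and
  \<open>p1' / (1 - p1') = q (1 - p2) / p2\<close>. The factors \<open>1 - p\<close> and p fit the exchange of open and
  closed cells. The factors q contribute one power of q for every i-cell outside \<open>P1\<close> and one for
  every (i+1)-cell outside \<open>P2\<close>; together with the quotient of the sizes of the two cohomology groups
  this is one power of q for every (i+1)-cell of the torus, independently of \<open>P1\<close> and \<open>P2\<close>.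
\<close>

lemma coupled_weight_dual:
  fixes p2 p1 p2' p1' :: real
  assumes q: "q > 0" and "i < d" and p: "p2 \<in> {0..1}" "p1 \<in> {0..1}"
    and p2': "p2' = real q * (1 - p1) / (p1 + real q * (1 - p1))"
    and p1': "p1' = real q * (1 - p2) / (p2 + real q * (1 - p2))"
    and P: "P2 \<in> percolation_subcomplexes (torus d N) (i + 1)" "P1 \<in> percolation_subcomplexes (torus d N) i"
  shows "coupled_weight p2' p1' q (d - i - 1) (dual_torus d N) (dual_subcomplex d N P1) (dual_subcomplex d N P2) =
    real q ^ card (jcells (torus d N) (i + 1)) /
      ((p1 + real q * (1 - p1)) ^ card (jcells (torus d N) i) *
       (p2 + real q * (1 - p2)) ^ card (jcells (torus d N) (i + 1))) *
    coupled_weight p2 p1 q i (torus d N) P2 P1"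
proof -
  let ?T = "torus d N" and ?T' = "dual_torus d N" and ?D = "dual_cube d N"
  define Z1 Z2 where "Z1 = p1 + real q * (1 - p1)" and "Z2 = p2 + real q * (1 - p2)"
  define a where "a = card (P2 \<inter> jcells ?T (i + 1))"
  define a' where "a' = card (jcells ?T (i + 1) - P2)"
  define b where "b = card (P1 \<inter> jcells ?T i)"
  define b' where "b' = card (jcells ?T i - P1)"
  define h where "h = card (relative_cohomology q ?T P2 P1 i)"
  define h' where "h' = card (relative_cohomology q ?T' (dual_subcomplex d N P1) (dual_subcomplex d N P2) (d - i - 1))"
  have q_real: "real q > 0" using q by simp
  have Z: "Z1 > 0" "Z2 > 0" "1 - p2' = p1 / Z1" "1 - p1' = p2 / Z2" "p2' = real q * (1 - p1) / Z1"
    "p1' = real q * (1 - p2) / Z2"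
    unfolding Z1_def Z2_def
    by (fact dual_parameter[OF p(2) q_real p2'] dual_parameter[OF p(1) q_real p1'] p2' p1')+
  have dims: "d - i - 1 + 1 = d - i" "d - i - 1 = d - (i + 1)" "i \<le> d" "i + 1 \<le> d" using assms by auto
  note inj = inj_on_subset[OF bij_betw_imp_inj_on[OF bij_betw_dual_cube[of d N]]]
  have card_D: "card (?D ` A) = card A" if "A \<subseteq> jcells ?T j" for A j
    using that by (intro card_image inj) (auto simp: jcells_def)
  have split: "card (jcells ?T j) = card (P \<inter> jcells ?T j) + card (jcells ?T j - P)" for P j
    using finite_torus(1)[of d N] card_Int_Diff[of "jcells ?T j" P] by (simp add: jcells_def Int_commute)
  have A: "card (jcells ?T (i + 1)) = a + a'" "card (jcells ?T i) = b + b'"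
    unfolding a_def a'_def b_def b'_def by (rule split)+
  have dual_cards: "card (dual_subcomplex d N P1 \<inter> jcells ?T' (d - i - 1 + 1)) = b'"
    "card (jcells ?T' (d - i - 1 + 1)) = b + b'"
    "card (dual_subcomplex d N P2 \<inter> jcells ?T' (d - i - 1)) = a'"
    "card (jcells ?T' (d - i - 1)) = a + a'"
    unfolding dims(1) unfolding dims(2)
    unfolding dual_subcomplex_jcells[OF dims(3)] dual_subcomplex_jcells[OF dims(4)]
    by (simp_all only: jcells_dual_torus[OF dims(3)] jcells_dual_torus[OF dims(4)] A
        a'_def b'_def card_D[OF Diff_subset] card_D[OF subset_refl])
  have "h * q ^ a = h' * q ^ b'"
    unfolding h_def h'_def a_def b'_def using card_relative_cohomology_dual[OF q \<open>i < d\<close> P] .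
  then have h: "real h * real q ^ a = real h' * real q ^ b'"
    by (metis of_nat_mult of_nat_power)
  have "coupled_weight p2' p1' q (d - i - 1) ?T' (dual_subcomplex d N P1) (dual_subcomplex d N P2) =
      p2' ^ b' * (1 - p2') ^ b * p1' ^ a' * (1 - p1') ^ a * real h'"
    unfolding coupled_weight_def dual_cards h'_def by simp
  \<comment> \<open>Of the powers of q produced by the dual parameters, \<open>q ^ b'\<close> converts h' into h times \<open>q ^ a\<close>.\<close>
  also have "\<dots> = (real h' * real q ^ b') * real q ^ a' * ((1 - p1) ^ b' * p1 ^ b * (1 - p2) ^ a' * p2 ^ a) /
      (Z1 ^ (b + b') * Z2 ^ (a + a'))"
    unfolding Z(3,4) unfolding Z(5,6) by (simp add: power_divide power_mult_distrib power_add mult_ac)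
  also have "\<dots> = real q ^ (a + a') / (Z1 ^ (b + b') * Z2 ^ (a + a')) *
      (p2 ^ a * (1 - p2) ^ a' * p1 ^ b * (1 - p1) ^ b' * real h)"
    unfolding h[symmetric] by (simp add: power_add)
  also have "p2 ^ a * (1 - p2) ^ a' * p1 ^ b * (1 - p1) ^ b' * real h = coupled_weight p2 p1 q i ?T P2 P1"
    unfolding coupled_weight_def A a_def[symmetric] b_def[symmetric] h_def by simp
  finally show ?thesis unfolding A Z1_def Z2_def .
qed

theorem theorem15:
  fixes q d N i :: nat and p2 p1 p2' p1' :: real and P2 P1 :: "cube set"
  assumes "prime q" and "d \<ge> 1" and "N \<ge> 1" and "i \<le> d - 1"
    and "p2 \<in> {0..1}" and "p1 \<in> {0..1}"
    and "p2' = real q * (1 - p1) / (p1 + real q * (1 - p1))"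
    and "p1' = real q * (1 - p2) / (p2 + real q * (1 - p2))"
    and "P2 \<in> percolation_subcomplexes (torus d N) (i + 1)"
    and "P1 \<in> percolation_subcomplexes (torus d N) i"
  shows "pmf (coupled_percolation p2 p1 q i (torus d N)) (P2, P1) =
    pmf (coupled_percolation p2' p1' q (d - i - 1) (dual_torus d N))
      (dual_subcomplex d N P1, dual_subcomplex d N P2)"
proof -
  let ?T = "torus d N" and ?T' = "dual_torus d N" and ?\<delta> = "dual_subcomplex d N"
  let ?C = "coupled_configurations i ?T" and ?C' = "coupled_configurations (d - i - 1) ?T'"
  let ?w = "coupled_weight p2 p1 q i ?T" and ?w' = "coupled_weight p2' p1' q (d - i - 1) ?T'"
  have q: "q > 0" using assms(1) by (rule prime_gt_0_nat)
  have i: "i < d" using assms by linarith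
  note Z = dual_parameter[OF assms(6) _ assms(7)] dual_parameter[OF assms(5) _ assms(8)]
  have p': "p2' \<in> {0..1}" "p1' \<in> {0..1}" using Z q by simp_all
  define c where "c = real q ^ card (jcells ?T (i + 1)) /
      ((p1 + real q * (1 - p1)) ^ card (jcells ?T i) * (p2 + real q * (1 - p2)) ^ card (jcells ?T (i + 1)))"
  have c: "c > 0" unfolding c_def using Z(1,4) q by simp
  \<comment> \<open>The constant c is the same for all configurations, so it cancels after normalization.\<close>
  have weight: "?w' (?\<delta> Q1) (?\<delta> Q2) = c * ?w Q2 Q1" if "(Q2, Q1) \<in> ?C" for Q2 Q1
    unfolding c_def using coupled_weight_dual[OF q i assms(5-8)] that
    by (simp add: coupled_configurations_def)
  have bij: "bij_betw (\<lambda>(Q2, Q1). (?\<delta> Q1, ?\<delta> Q2)) ?C ?C'"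
  proof -
    have "d - i - 1 + 1 = d - i" "d - i - 1 = d - (i + 1)" "i \<le> d" "i + 1 \<le> d" using i by auto
    then have "bij_betw ?\<delta> (percolation_subcomplexes ?T i) (percolation_subcomplexes ?T' (d - i - 1 + 1))"
      "bij_betw ?\<delta> (percolation_subcomplexes ?T (i + 1)) (percolation_subcomplexes ?T' (d - i - 1))"
      by (simp_all only: bij_betw_dual_subcomplex)
    then have inj: "inj_on ?\<delta> (percolation_subcomplexes ?T i)" "inj_on ?\<delta> (percolation_subcomplexes ?T (i + 1))"
      and img: "percolation_subcomplexes ?T' (d - i - 1 + 1) = ?\<delta> ` percolation_subcomplexes ?T i"
        "percolation_subcomplexes ?T' (d - i - 1) = ?\<delta> ` percolation_subcomplexes ?T (i + 1)"
      unfolding bij_betw_def by blast+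
    show ?thesis
      unfolding coupled_configurations_def img
      by (rule bij_betw_imageI) (use inj in \<open>auto simp: inj_on_def\<close>)
  qed
  have "coupled_partition_function p2' p1' q (d - i - 1) ?T' = (\<Sum>(Q2, Q1)\<in>?C. ?w' (?\<delta> Q1) (?\<delta> Q2))"
    unfolding coupled_partition_function_def
    by (subst sum.reindex_bij_betw[OF bij, symmetric]) (simp add: case_prod_unfold)
  also have "\<dots> = c * coupled_partition_function p2 p1 q i ?T"
    unfolding coupled_partition_function_def sum_distrib_left
    by (intro sum.cong refl, clarify) (simp only: case_prod_conv weight)
  finally have partition: "coupled_partition_function p2' p1' q (d - i - 1) ?T' =
      c * coupled_partition_function p2 p1 q i ?T" .
  have conf: "(P2, P1) \<in> ?C" using assms by (simp add: coupled_configurations_def)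
  then have conf': "(?\<delta> P1, ?\<delta> P2) \<in> ?C'" using bij_betwE[OF bij] by fastforce
  have pmf: "pmf (coupled_percolation r2 r1 q j (shifted_torus d N s)) (Q2, Q1) =
      coupled_weight r2 r1 q j (shifted_torus d N s) Q2 Q1 /
      coupled_partition_function r2 r1 q j (shifted_torus d N s)"
    if "(Q2, Q1) \<in> coupled_configurations j (shifted_torus d N s)" "r2 \<in> {0..1}" "r1 \<in> {0..1}"
    for r2 r1 j s Q2 Q1
    using pmf_coupled_percolation[OF finite_shifted_torus shifted_torus_face_dim q that(2,3)] that(1)
    by simp
  have "pmf (coupled_percolation p2 p1 q i ?T) (P2, P1) = ?w P2 P1 / coupled_partition_function p2 p1 q i ?T"
    using pmf conf assms(5,6) unfolding torus_def by blast
  also have "\<dots> = ?w' (?\<delta> P1) (?\<delta> P2) / coupled_partition_function p2' p1' q (d - i - 1) ?T'"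
    unfolding partition weight[OF conf] using c by simp
  also have "\<dots> = pmf (coupled_percolation p2' p1' q (d - i - 1) ?T') (?\<delta> P1, ?\<delta> P2)"
    using pmf conf' p' unfolding dual_torus_def by metis
  finally show ?thesis .
qed

end
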